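(* Let $G$ be a $\mathfrak{C}_8$-group. Then $G$ is a $p$-group for some prime number $p$ if and only if $G\cong (C_3)^4$ or $G\cong (C_7)^2$.
   Context: $(C_k)^m$ denotes the direct product of $m$ copies of the cyclic group $C_k$ of order $k$. A cover for a group $G$ is a set $\mathcal{C}$ of proper subgroups of $G$ whose set-theoretic union is $G$. It is irredundant if no proper subset of $\mathcal{C}$ is a cover for $G$, maximal if all members of $\mathcal{C}$ are maximal subgroups of $G$, and core-free if $D=\bigcap_{M\in\mathcal{C}}M$ is core-free in $G$, i.e. $\bigcap_{g\in G}g^{-1}Dg=1$. A $\mathfrak{C}_n$-cover for $G$ is an irredundant maximal core-free cover $\mathcal{C}$ for $G$ with $|\mathcal{C}|=n$; a group having a $\mathfrak{C}_n$-cover is called a $\mathfrak{C}_n$-group. *)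

theory Defs
  imports "HOL-Algebra.Algebra"
begin

definition proper_subgroup :: "'a set \<Rightarrow> ('a, 'b) monoid_scheme \<Rightarrow> bool" where
  "proper_subgroup H G \<longleftrightarrow> subgroup H G \<and> H \<noteq> carrier G"

definition maximal_subgroup :: "'a set \<Rightarrow> ('a, 'b) monoid_scheme \<Rightarrow> bool" where
  "maximal_subgroup M G \<longleftrightarrow>
     proper_subgroup M G \<and> (\<forall>H. proper_subgroup H G \<longrightarrow> M \<subseteq> H \<longrightarrow> H = M)"

definition group_cover :: "('a, 'b) monoid_scheme \<Rightarrow> 'a set set \<Rightarrow> bool" where
  "group_cover G \<C> \<longleftrightarrow> (\<forall>H\<in>\<C>. proper_subgroup H G) \<and> \<Union>\<C> = carrier G"

definition irredundant_cover :: "('a, 'b) monoid_scheme \<Rightarrow> 'a set set \<Rightarrow> bool" where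
  "irredundant_cover G \<C> \<longleftrightarrow> group_cover G \<C> \<and> (\<forall>\<D>. \<D> \<subset> \<C> \<longrightarrow> \<not> group_cover G \<D>)"

definition maximal_cover :: "('a, 'b) monoid_scheme \<Rightarrow> 'a set set \<Rightarrow> bool" where
  "maximal_cover G \<C> \<longleftrightarrow> group_cover G \<C> \<and> (\<forall>M\<in>\<C>. maximal_subgroup M G)"

definition normal_core :: "('a, 'b) monoid_scheme \<Rightarrow> 'a set \<Rightarrow> 'a set" where
  "normal_core G D = (\<Inter>g\<in>carrier G. inv\<^bsub>G\<^esub> g <#\<^bsub>G\<^esub> (D #>\<^bsub>G\<^esub> g))"

definition core_free_cover :: "('a, 'b) monoid_scheme \<Rightarrow> 'a set set \<Rightarrow> bool" where
  "core_free_cover G \<C> \<longleftrightarrow> group_cover G \<C> \<and> normal_core G (\<Inter>\<C>) = {\<one>\<^bsub>G\<^esub>}"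

definition CC_cover :: "nat \<Rightarrow> ('a, 'b) monoid_scheme \<Rightarrow> 'a set set \<Rightarrow> bool" where
  "CC_cover n G \<C> \<longleftrightarrow>
     irredundant_cover G \<C> \<and> maximal_cover G \<C> \<and> core_free_cover G \<C> \<and>
     finite \<C> \<and> card \<C> = n"

definition CC_group :: "nat \<Rightarrow> ('a, 'b) monoid_scheme \<Rightarrow> bool" where
  "CC_group n G \<longleftrightarrow> group G \<and> (\<exists>\<C>. CC_cover n G \<C>)"

(* The groups here are not assumed finite, so p-groups are defined elementwise;
   group.ord is 0, hence not a power of a prime, on elements of infinite order. *)
definition p_group :: "nat \<Rightarrow> ('a, 'b) monoid_scheme \<Rightarrow> bool" where
  "p_group p G \<longleftrightarrow> group G \<and> (\<forall>x\<in>carrier G. \<exists>k. group.ord G x = p ^ k)"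

definition cyclic_power :: "nat \<Rightarrow> nat \<Rightarrow> (nat \<Rightarrow> int) monoid" where
  "cyclic_power k m = product_group {..<m} (\<lambda>_. integer_mod_group k)"

end

theory Submission
  imports Defs
begin

text \<open>
  By B. H. Neumann's lemma the members of an irredundant finite cover have finite index, so a
  group with a core-free such cover is finite. In a finite \<open>p\<close>-group maximal subgroups are kernels
  of homomorphisms onto the cyclic group of order \<open>p\<close>, so core-freeness forces the intersection
  of the cover to be trivial, and \<open>G\<close> is elementary abelian. Let \<open>n(x)\<close> be the number of members
  containing \<open>x\<close>. Irredundancy gives \<open>1 \<le> n(x) \<le> 8 - p\<close> for \<open>x \<noteq> 1\<close>, and the first two moments
  of \<open>n\<close> are determined by \<open>p\<close> and \<open>|G|\<close>. This forces \<open>|G| = 49\<close> for \<open>p = 7\<close>, excludes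
  \<open>p = 5\<close>, and together with the elements that lie in a single member gives \<open>|G| \<ge> 81\<close> for
  \<open>p = 3\<close>. For \<open>p = 2\<close> a parity argument applies. Finally, if \<open>p = 3\<close>, then the number of
  elements outside all members is, by Fourier inversion, an alternating weighted count of the linear
  relations between the eight characters; as \<open>n(x) \<le> 5\<close> for \<open>x \<noteq> 1\<close>, the moments of the number
  of characters not involved in a relation are known up to order two, and a quadratic lower bound
  for the weights shows that the count is positive as soon as \<open>|G| \<ge> 243\<close>.
\<close>


section \<open>Finite index and finite covers\<close>

context group
begin

text \<open>Allows a cover of one coset to be carried over to every other coset by right
  translation.\<close>

lemma rcosets_translate:
  assumes "subgroup H G" "x \<in> carrier G" "y \<in> carrier G"
  shows "H #> y = (H #> x) #> (inv x \<otimes> y)"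
  using assms by (simp add: coset_mult_assoc subgroup.subset m_assoc[symmetric])

text \<open>B. H. Neumann's lemma: if \<open>H\<close> has infinite index, then some coset of \<open>H\<close> is missing from the
  cover, hence covered by cosets of the other subgroups; its translates then replace every coset
  of \<open>H\<close>.\<close>

lemma coset_cover_finite_index:
  assumes "finite \<H>" "\<And>H. H \<in> \<H> \<Longrightarrow> subgroup H G"
    and "finite \<T>" "\<And>T. T \<in> \<T> \<Longrightarrow> \<exists>H\<in>\<H>. T \<in> rcosets H"
    and "carrier G \<subseteq> \<Union>\<T>"
  shows "\<exists>H\<in>\<H>. finite (rcosets H)"
  using assms
proof (induction \<H> arbitrary: \<T> rule: finite_induct)
  case empty
  then have "\<T> = {}" by auto
  then show ?case using empty by auto
next
  case (insert H \<H>)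
  show ?case
  proof (cases "finite (rcosets H)")
    case True
    then show ?thesis by blast
  next
    case False
    have sH: "subgroup H G" using insert by blast
    obtain C where C: "C \<in> rcosets H" "C \<notin> \<T>"
      using False insert.prems(2) by (meson finite_subset subsetI)
    then obtain x where x: "x \<in> carrier G" "C = H #> x" by (auto simp: RCOSETS_def)
    define \<U> where "\<U> = {T \<in> \<T>. \<exists>K\<in>\<H>. T \<in> rcosets K}"
    have CU: "C \<subseteq> \<Union>\<U>"
    proof
      fix c assume c: "c \<in> C"
      then have "c \<in> carrier G" using C(1) sH rcosets_part_G by blast
      then obtain T where T: "T \<in> \<T>" "c \<in> T" using insert.prems(4) by auto
      \<comment> \<open>Distinct cosets of \<open>H\<close> are disjoint, and \<open>C\<close> is
        not in \<open>\<T>\<close>; so a set of \<open>\<T>\<close> that meets \<open>C\<close> is a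
        coset of another subgroup.\<close>
      have "T \<notin> rcosets H"
        using T C c rcos_disjoint[OF sH] unfolding pairwise_def disjnt_iff by metis
      then have "T \<in> \<U>" using T insert.prems(3) unfolding \<U>_def by auto
      then show "c \<in> \<Union>\<U>" using T by auto
    qed
    have "finite (\<T> \<inter> rcosets H)" using insert.prems(2) by simp
    moreover have "\<T> \<inter> rcosets H \<subseteq> (\<lambda>y. H #> y) ` carrier G" by (auto simp: RCOSETS_def)
    ultimately obtain Y where Y: "Y \<subseteq> carrier G" "finite Y" "\<T> \<inter> rcosets H = (\<lambda>y. H #> y) ` Y"
      by (meson finite_subset_image)
    define \<V> where "\<V> = \<U> \<union> (\<lambda>(T, y). T #> (inv x \<otimes> y)) ` (\<U> \<times> Y)"
    show ?thesis
    proof -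
      have "finite \<U>" unfolding \<U>_def using insert.prems(2) by simp
      then have "finite \<V>" unfolding \<V>_def using Y(2) by blast
      moreover have "\<exists>K\<in>\<H>. V \<in> rcosets K" if V: "V \<in> \<V>" for V
      proof (cases "V \<in> \<U>")
        case True
        then show ?thesis by (auto simp: \<U>_def)
      next
        case False
        then obtain T y where Ty: "T \<in> \<U>" "y \<in> Y" "V = T #> (inv x \<otimes> y)"
          using V by (auto simp: \<V>_def)
        then obtain K z where K: "K \<in> \<H>" "z \<in> carrier G" "T = K #> z"
          by (auto simp: \<U>_def RCOSETS_def)
        have sK: "subgroup K G" using K insert.prems(1) by blast
        have yc: "y \<in> carrier G" using Ty Y by auto
        have "V = K #> (z \<otimes> (inv x \<otimes> y))"
          using Ty K x yc subgroup.subset[OF sK] by (simp add: coset_mult_assoc)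
        then have "V \<in> rcosets K"
          using K x yc subgroup.subset[OF sK] by (auto intro!: rcosetsI)
        then show ?thesis using K by blast
      qed
      moreover have "carrier G \<subseteq> \<Union>\<V>"
      proof
        fix c assume c: "c \<in> carrier G"
        then obtain T where T: "T \<in> \<T>" "c \<in> T" using insert.prems(4) by auto
        show "c \<in> \<Union>\<V>"
        proof (cases "T \<in> rcosets H")
          case True
          then obtain y where y: "y \<in> Y" "T = H #> y" using T Y(3) by blast
          then have "T = C #> (inv x \<otimes> y)"
            unfolding x(2) y(2) using rcosets_translate[OF sH x(1)] Y(1) y(1) by blast
          then obtain d where d: "d \<in> C" "c = d \<otimes> (inv x \<otimes> y)"
            using T by (auto simp: r_coset_def)
          then obtain U where "U \<in> \<U>" "d \<in> U" using CU by auto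
          then have "c \<in> U #> (inv x \<otimes> y)" "U #> (inv x \<otimes> y) \<in> \<V>"
            using d y by (auto simp: r_coset_def \<V>_def)
          then show ?thesis by blast
        next
          case False
          then have "T \<in> \<V>" using T insert.prems(3) by (auto simp: \<V>_def \<U>_def)
          then show ?thesis using T by blast
        qed
      qed
      ultimately show ?thesis using insert.IH[of \<V>] insert.prems(1) by blast
    qed
  qed
qed

text \<open>A coset of \<open>H \<inter> K\<close> is the intersection of the cosets of
  \<open>H\<close> and of \<open>K\<close> with the same representative, so it is determined by one
  of finitely many pairs.\<close>

lemma finite_rcosets_Int:
  assumes "subgroup H G" "subgroup K G" "finite (rcosets H)" "finite (rcosets K)"
  shows "finite (rcosets (H \<inter> K))"
proof -
  have "rcosets (H \<inter> K) \<subseteq> (\<lambda>(A, B). A \<inter> B) ` ((rcosets H) \<times> (rcosets K))"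
  proof
    fix C assume "C \<in> rcosets (H \<inter> K)"
    then obtain x where x: "x \<in> carrier G" "C = (H \<inter> K) #> x" by (auto simp: RCOSETS_def)
    have "C = (H #> x) \<inter> (K #> x)"
    proof
      show "(H #> x) \<inter> (K #> x) \<subseteq> C"
      proof
        fix c assume "c \<in> (H #> x) \<inter> (K #> x)"
        then obtain h k where hk: "h \<in> H" "k \<in> K" "c = h \<otimes> x" "c = k \<otimes> x"
          unfolding r_coset_def by blast
        then have "h = k"
          using x subgroup.mem_carrier[OF assms(1)] subgroup.mem_carrier[OF assms(2)]
          by (metis r_cancel)
        then show "c \<in> C" using hk x unfolding r_coset_def by blast
      qed
    qed (auto simp: x r_coset_def)
    moreover have "H #> x \<in> rcosets H" "K #> x \<in> rcosets K"
      using x by (auto simp: RCOSETS_def)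
    ultimately show "C \<in> (\<lambda>(A, B). A \<inter> B) ` ((rcosets H) \<times> (rcosets K))" by auto
  qed
  then show ?thesis using assms by (meson finite_SigmaI finite_imageI finite_subset)
qed

lemma finite_rcosets_carrier: "finite (rcosets (carrier G))"
proof -
  have "rcosets (carrier G) \<subseteq> {carrier G}"
    by (auto simp: RCOSETS_def coset_join2 subgroup_self)
  then show ?thesis by (rule finite_subset) simp
qed

text \<open>The factor \<open>carrier G\<close> takes care of the empty family, whose intersection
  is the whole type.\<close>

lemma subgroup_carrier_Inter:
  assumes "\<And>H. H \<in> \<H> \<Longrightarrow> subgroup H G"
  shows "subgroup (carrier G \<inter> \<Inter>\<H>) G"
proof (rule subgroupI)
  show "carrier G \<inter> \<Inter>\<H> \<noteq> {}"
    using subgroup.one_closed[OF assms] by blast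
qed (use assms in \<open>auto simp: subgroup.m_inv_closed subgroup.m_closed\<close>)

lemma finite_rcosets_Inter:
  assumes "finite \<H>" "\<And>H. H \<in> \<H> \<Longrightarrow> subgroup H G" "\<And>H. H \<in> \<H> \<Longrightarrow> finite (rcosets H)"
  shows "finite (rcosets (carrier G \<inter> \<Inter>\<H>))"
  using assms
proof (induction \<H> rule: finite_induct)
  case empty
  then show ?case by (simp add: finite_rcosets_carrier)
next
  case (insert H \<H>)
  have "finite (rcosets (H \<inter> (carrier G \<inter> \<Inter>\<H>)))"
    by (rule finite_rcosets_Int[OF _ subgroup_carrier_Inter]) (use insert in auto)
  moreover have "H \<inter> (carrier G \<inter> \<Inter>\<H>) = carrier G \<inter> \<Inter>(insert H \<H>)"
    by auto
  ultimately show ?case by simp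
qed

text \<open>Otherwise the members of finite index form a proper subfamily and miss some
  \<open>x\<close>. Their intersection \<open>K\<close> has finite index and \<open>K #> x\<close>
  avoids all of them, so the members of infinite index cover \<open>K #> x\<close>. Finitely many
  translates then cover the group by cosets of subgroups of infinite index, against Neumann's
  lemma.\<close>

lemma irredundant_cover_finite_index:
  assumes fin: "finite \<C>" and sub: "\<And>M. M \<in> \<C> \<Longrightarrow> subgroup M G"
    and irr: "\<And>\<D>. \<D> \<subset> \<C> \<Longrightarrow> \<Union>\<D> \<noteq> carrier G" and cov: "\<Union>\<C> = carrier G"
    and M: "M \<in> \<C>"
  shows "finite (rcosets M)"
proof (rule ccontr)
  assume inf: "infinite (rcosets M)"
  define \<F> where "\<F> = {N \<in> \<C>. finite (rcosets N)}"
  define K where "K = carrier G \<inter> \<Inter>\<F>"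
  have "\<F> \<subset> \<C>" using inf M by (auto simp: \<F>_def)
  then have "\<Union>\<F> \<noteq> carrier G" "\<Union>\<F> \<subseteq> carrier G" using irr cov by (blast, auto)
  then obtain x where x: "x \<in> carrier G" "x \<notin> \<Union>\<F>" by auto
  have sK: "subgroup K G" unfolding K_def by (rule subgroup_carrier_Inter) (auto simp: \<F>_def sub)
  have fK: "finite (rcosets K)"
    unfolding K_def by (rule finite_rcosets_Inter) (use fin in \<open>auto simp: \<F>_def sub\<close>)
  have Kx: "K #> x \<subseteq> \<Union>(\<C> - \<F>)"
  proof
    fix z assume "z \<in> K #> x"
    then obtain k where k: "k \<in> K" "z = k \<otimes> x" by (auto simp: r_coset_def)
    have kc: "k \<in> carrier G" using k by (auto simp: K_def)
    then have "z \<in> \<Union>\<C>" using cov k x by auto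
    moreover have "z \<notin> N" if "N \<in> \<F>" for N
    proof
      assume z: "z \<in> N"
      have sN: "subgroup N G" using that by (auto simp: \<F>_def sub)
      have "k \<in> N" using k that by (auto simp: K_def)
      then have "inv k \<otimes> z \<in> N" using z sN by (simp add: subgroup.m_closed subgroup.m_inv_closed)
      then have "x \<in> N" using k kc x by (simp add: m_assoc[symmetric])
      then show False using that x by auto
    qed
    ultimately show "z \<in> \<Union>(\<C> - \<F>)" by blast
  qed
  have "rcosets K \<subseteq> (\<lambda>y. K #> y) ` carrier G" by (auto simp: RCOSETS_def)
  then obtain Y where Y: "Y \<subseteq> carrier G" "finite Y" "rcosets K = (\<lambda>y. K #> y) ` Y"
    by (meson finite_subset_image fK)
  define \<T> where "\<T> = (\<lambda>(N, y). N #> (inv x \<otimes> y)) ` ((\<C> - \<F>) \<times> Y)"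
  have "\<exists>N\<in>\<C> - \<F>. finite (rcosets N)"
  proof (rule coset_cover_finite_index)
    show "finite \<T>" unfolding \<T>_def using fin Y by auto
    show "\<exists>N\<in>\<C> - \<F>. T \<in> rcosets N" if "T \<in> \<T>" for T
      using that x Y by (auto simp: \<T>_def RCOSETS_def intro!: bexI)
    show "carrier G \<subseteq> \<Union>\<T>"
    proof
      fix c assume "c \<in> carrier G"
      then obtain y where y: "y \<in> Y" "c \<in> K #> y"
        using rcosets_part_G[OF sK] unfolding Y(3) by blast
      then have "c \<in> (K #> x) #> (inv x \<otimes> y)"
        using rcosets_translate[OF sK x(1)] Y(1) by auto
      then obtain d where d: "d \<in> K #> x" "c = d \<otimes> (inv x \<otimes> y)" by (auto simp: r_coset_def)
      then obtain N where "N \<in> \<C> - \<F>" "d \<in> N" using Kx by auto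
      then have "c \<in> N #> (inv x \<otimes> y)" "N #> (inv x \<otimes> y) \<in> \<T>"
        using d y by (auto simp: r_coset_def \<T>_def)
      then show "c \<in> \<Union>\<T>" by blast
    qed
  qed (use fin sub in auto)
  then show False by (auto simp: \<F>_def)
qed

text \<open>The action of \<open>G\<close> on the cosets of \<open>D\<close> is faithful.\<close>

lemma finite_if_core_trivial:
  assumes D: "subgroup D G" and fin: "finite (rcosets D)" and core: "normal_core G D = {\<one>}"
  shows "finite (carrier G)"
proof -
  define f where "f g = (\<lambda>C\<in>rcosets D. C #> g)" for g
  note Dsub = subgroup.subset[OF D]
  have closed: "C #> g \<in> rcosets D" if "C \<in> rcosets D" "g \<in> carrier G" for C g
    using that Dsub by (auto simp: RCOSETS_def coset_mult_assoc)
  then have "f ` carrier G \<subseteq> rcosets D \<rightarrow>\<^sub>E rcosets D"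
    by (auto simp: f_def)
  then have "finite (f ` carrier G)" using fin by (meson finite_PiE finite_subset)
  moreover have "inj_on f (carrier G)"
  proof (rule inj_onI)
    fix g g' assume g: "g \<in> carrier G" "g' \<in> carrier G" "f g = f g'"
    \<comment> \<open>Equal action on the coset \<open>D #> y\<close> puts
      \<open>g \<otimes> inv g'\<close> into the conjugate of \<open>D\<close> by \<open>y\<close>;
      over all \<open>y\<close> these conjugates intersect in the core.\<close>
    have "g \<otimes> inv g' \<in> inv y <# (D #> y)" if y: "y \<in> carrier G" for y
    proof -
      have "D #> y \<in> rcosets D" using y by (auto simp: RCOSETS_def)
      then have "(D #> y) #> g = (D #> y) #> g'"
        using g(3) by (auto simp: f_def dest: fun_cong[where x = "D #> y"])
      then have eq: "D #> (y \<otimes> g) = D #> (y \<otimes> g')"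
        using g y Dsub by (simp add: coset_mult_assoc)
      have "y \<otimes> g \<in> D #> (y \<otimes> g')"
        using rcos_self[OF _ D, of "y \<otimes> g"] eq g y by auto
      then obtain d where d: "d \<in> D" "y \<otimes> g = d \<otimes> (y \<otimes> g')" by (auto simp: r_coset_def)
      have dc: "d \<in> carrier G" using d Dsub by auto
      have "g = inv y \<otimes> (d \<otimes> (y \<otimes> g'))" using d(2) g y dc by (metis inv_solve_left m_closed)
      then have "g \<otimes> inv g' = inv y \<otimes> (d \<otimes> y)"
        using g y dc by (simp add: m_assoc)
      then show ?thesis using d by (auto simp: l_coset_def r_coset_def)
    qed
    then have "g \<otimes> inv g' \<in> normal_core G D" by (auto simp: normal_core_def)
    then show "g = g'" using core g by (simp add: inv_solve_right')
  qed
  ultimately show ?thesis by (rule finite_imageD)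
qed

end

section \<open>Maximal subgroups of finite \<open>p\<close>-groups\<close>

text \<open>For a prime \<open>q\<close> dividing the order, Sylow's theorem gives a subgroup of
  order \<open>q\<close>. The order of a nontrivial element of it divides \<open>q\<close> and is a
  power of \<open>p\<close>, hence \<open>q = p\<close>.\<close>

lemma (in group) finite_p_group_order:
  assumes "finite (carrier G)" "Factorial_Ring.prime p" "p_group p G"
  shows "\<exists>e. order G = p ^ e"
proof -
  have only: "q = p" if q: "Factorial_Ring.prime q" "q dvd order G" for q
  proof -
    obtain m where "order G = q ^ 1 * m" using q by auto
    then obtain H where H: "subgroup H G" "card H = q"
      using sylow_thm[of q G 1 m] q assms is_group by auto
    have "\<not> H \<subseteq> {\<one>}"
    proof
      assume "H \<subseteq> {\<one>}"
      then have "card H \<le> 1" using card_mono[of "{\<one>}" H] by simp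
      then show False using H(2) prime_gt_1_nat[OF q(1)] by simp
    qed
    then obtain x where x: "x \<in> H" "x \<noteq> \<one>" by blast
    have xc: "x \<in> carrier G" using x subgroup.mem_carrier[OF H(1)] by blast
    have "x [^]\<^bsub>G\<lparr>carrier := H\<rparr>\<^esub> order (G\<lparr>carrier := H\<rparr>) = \<one>\<^bsub>G\<lparr>carrier := H\<rparr>\<^esub>"
      using x by (intro group.pow_order_eq_1[OF subgroup_imp_group[OF H(1)]]) auto
    then have "x [^] q = \<one>"
      using H(2) by (simp add: order_def nat_pow_consistent[symmetric])
    then have dvd: "ord x dvd q" using xc by (simp add: pow_eq_id)
    obtain k where k: "ord x = p ^ k" using assms(3) xc by (auto simp: p_group_def)
    have "k \<noteq> 0" using k x xc ord_eq_1 by (metis power_0)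
    then have "p dvd q" using dvd k by (metis dvd_power dvd_trans gr0I)
    then show "q = p" using assms(2) q(1) primes_dvd_imp_eq by blast
  qed
  have "order G \<noteq> 0" using assms(1) order_gt_0_iff_finite by auto
  then obtain m where m: "order G = p ^ multiplicity p (order G) * m" "\<not> p dvd m"
    using multiplicity_decompose'[of "order G" p] assms(2)
    by (metis not_prime_unit)
  have "m = 1"
  proof (rule ccontr)
    assume "m \<noteq> 1"
    then obtain q where "Factorial_Ring.prime q" "q dvd m" using prime_factor_nat by blast
    then show False using only[of q] m by (metis dvd_mult)
  qed
  then show ?thesis using m by auto
qed

text \<open>Orbit lengths divide \<open>p ^ a\<close>, so every orbit that is not a fixed point has
  length divisible by \<open>p\<close>. With \<open>x\<close> as the only fixed point,
  \<open>card E\<close> would be 1 modulo \<open>p\<close>.\<close>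

lemma (in group_action) another_fixed_point:
  assumes p: "Factorial_Ring.prime (p::nat)" and order: "order G = p ^ a"
    and E: "finite E" "p dvd card E"
    and x: "x \<in> E" "\<And>g. g \<in> carrier G \<Longrightarrow> \<phi> g x = x"
  shows "\<exists>y\<in>E. y \<noteq> x \<and> (\<forall>g\<in>carrier G. \<phi> g y = y)"
proof (rule ccontr)
  assume nofix: "\<not> ?thesis"
  interpret group G using group_hom group_hom.axioms(1) by blast
  have one: "\<one> \<in> carrier G" by simp
  have ox: "orbit G \<phi> x = {x}" using x one unfolding orbit_def by force
  have sub: "O1 \<subseteq> E" if "O1 \<in> orbits G E \<phi>" for O1
    using that element_image by (auto simp: orbits_def orbit_def)
  have big: "p dvd card O1" if O1: "O1 \<in> orbits G E \<phi> - {{x}}" for O1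
  proof -
    obtain y where y: "y \<in> E" "O1 = orbit G \<phi> y" using O1 by (auto simp: orbits_def)
    have "card O1 * card (stabilizer G \<phi> y) = p ^ a"
      using orbit_stabilizer_theorem[OF y(1)] y(2) order by simp
    then have "card O1 dvd p ^ a" by (metis dvd_triv_left)
    then obtain i where i: "card O1 = p ^ i" using p divides_primepow_nat by blast
    have "y \<noteq> x" using O1 y ox by auto
    then obtain g where g: "g \<in> carrier G" "\<phi> g y \<noteq> y" using nofix y by blast
    have "i \<noteq> 0"
    proof
      assume "i = 0"
      then have "card O1 = 1" using i by simp
      then obtain z where "O1 = {z}" by (auto simp: card_1_singleton_iff)
      moreover have "y \<in> O1" using orbit_refl[OF y(1)] y(2) by simp
      moreover have "\<phi> g y \<in> O1" using g(1) y(2) by (auto simp: orbit_def)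
      ultimately show False using g by auto
    qed
    then show ?thesis using i by simp
  qed
  have fo: "finite (orbits G E \<phi>)" using sub E by (meson PowI finite_Pow_iff finite_subset subsetI)
  have xo: "{x} \<in> orbits G E \<phi>" using x ox by (auto simp: orbits_def)
  have "card E = card (\<Union>(orbits G E \<phi>))"
    using orbits_coverture by simp
  also have "\<dots> = (\<Sum>O1\<in>orbits G E \<phi>. card O1)"
  proof (rule card_Union_disjoint)
    show "disjoint (orbits G E \<phi>)"
      using disjoint_union by (auto simp: pairwise_def disjnt_def)
  qed (use sub E finite_subset in blast)
  also have "\<dots> = card {x} + (\<Sum>O1\<in>orbits G E \<phi> - {{x}}. card O1)"
    by (rule sum.remove[OF fo xo])
  finally have "card E = 1 + (\<Sum>O1\<in>orbits G E \<phi> - {{x}}. card O1)" by simp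
  moreover have "p dvd (\<Sum>O1\<in>orbits G E \<phi> - {{x}}. card O1)"
    using big by (rule dvd_sum)
  ultimately have "p dvd 1" using E(2) by (metis dvd_add_left_iff)
  then show False using p by simp
qed

text \<open>Right multiplication reverses products; the inverse in \<open>C #> inv h\<close> turns
  it into a homomorphism to \<open>BijGroup\<close>.\<close>

lemma (in group) rcosets_action:
  assumes "subgroup M G"
  shows "group_action (G\<lparr>carrier := M\<rparr>) (rcosets M) (\<lambda>h. \<lambda>C\<in>rcosets M. C #> inv h)"
proof -
  let ?f = "\<lambda>h. \<lambda>C\<in>rcosets M. C #> inv h"
  note Msub = subgroup.subset[OF assms] 
  note mem = subgroup.mem_carrier[OF assms]
  have Csub: "C \<subseteq> carrier G" if "C \<in> rcosets M" for C
    using rcosets_subset_PowG[OF assms] that by blast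
  have closed: "C #> g \<in> rcosets M" if "C \<in> rcosets M" "g \<in> carrier G" for C g
    using that Msub by (auto simp: RCOSETS_def coset_mult_assoc)
  have inv1: "C #> g #> inv g = C" "C #> inv g #> g = C"
    if "C \<in> rcosets M" "g \<in> carrier G" for C g
    using that Csub by (simp_all add: coset_mult_assoc)
  have bij: "?f h \<in> Bij (rcosets M)" if "h \<in> M" for h
  proof -
    have "bij_betw (?f h) (rcosets M) (rcosets M)"
      by (rule bij_betw_byWitness[where f' = "\<lambda>C. C #> h"])
        (use that mem closed inv1 in auto)
    then show ?thesis by (simp add: Bij_def)
  qed
  interpret M: group "G\<lparr>carrier := M\<rparr>" by (rule subgroup_imp_group[OF assms])
  have "?f \<in> hom (G\<lparr>carrier := M\<rparr>) (BijGroup (rcosets M))"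
  proof (rule homI)
    fix h assume "h \<in> carrier (G\<lparr>carrier := M\<rparr>)"
    then show "?f h \<in> carrier (BijGroup (rcosets M))" using bij by (simp add: BijGroup_def)
  next
    fix h k assume "h \<in> carrier (G\<lparr>carrier := M\<rparr>)" "k \<in> carrier (G\<lparr>carrier := M\<rparr>)"
    then have hk: "h \<in> M" "k \<in> M" by auto
    have "?f (h \<otimes> k) C = compose (rcosets M) (?f h) (?f k) C" for C
      using hk mem closed Csub
      by (auto simp: compose_def coset_mult_assoc inv_mult_group)
    then show "?f (h \<otimes>\<^bsub>G\<lparr>carrier := M\<rparr>\<^esub> k) = ?f h \<otimes>\<^bsub>BijGroup (rcosets M)\<^esub> ?f k"
      using bij hk by (simp add: BijGroup_def ext)
  qed
  then show ?thesis
    by (simp add: group_action_def group_hom_def group_hom_axioms_def group_BijGroup M.is_group)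
qed

text \<open>Acting on its own cosets, \<open>M\<close> fixes \<open>M\<close>, hence a second coset \<open>Mg\<close>; this puts \<open>g\<close> into the
  normalizer of \<open>M\<close>.\<close>

lemma (in group) maximal_subgroup_normal:
  assumes p: "Factorial_Ring.prime (p::nat)" and order: "order G = p ^ e"
    and M: "maximal_subgroup M G"
  shows "M \<lhd> G"
proof -
  have fin: "finite (carrier G)"
    using order p order_gt_0_iff_finite by (metis prime_gt_0_nat zero_less_power)
  have sM: "subgroup M G" and MG: "M \<noteq> carrier G"
    using M by (auto simp: maximal_subgroup_def proper_subgroup_def)
  note Msub = subgroup.subset[OF sM]
  note mem = subgroup.mem_carrier[OF sM]
  have finM: "finite M" using fin Msub finite_subset by blast
  have lag: "card (rcosets M) * card M = p ^ e" using lagrange[OF sM] order by simp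
  then obtain i where i: "card (rcosets M) = p ^ i"
    using divides_primepow_nat[OF p] by (metis dvd_triv_left)
  obtain a where a: "card M = p ^ a"
    using divides_primepow_nat[OF p] lag by (metis dvd_triv_right)
  have finR: "finite (rcosets M)"
    using fin rcosets_subset_PowG[OF sM] by (meson finite_Pow_iff finite_subset)
  have "i \<noteq> 0"
  proof
    assume "i = 0"
    then have "card M = card (carrier G)" using lag i order by (simp add: order_def)
    then show False using MG Msub fin card_subset_eq by blast
  qed
  then have dvd: "p dvd card (rcosets M)" using i by simp
  interpret act: group_action "G\<lparr>carrier := M\<rparr>" "rcosets M" "\<lambda>h. \<lambda>C\<in>rcosets M. C #> inv h"
    by (rule rcosets_action[OF sM])
  have MR: "M \<in> rcosets M" using sM subgroup.subgroup_in_rcosets is_group by blast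
  obtain C where C: "C \<in> rcosets M" "C \<noteq> M" "\<And>h. h \<in> M \<Longrightarrow> C #> inv h = C"
    using act.another_fixed_point[OF p, of a M] a finR dvd MR
    by (auto simp: order_def coset_join2 subgroup.m_inv_closed sM mem)
  then obtain g where g: "g \<in> carrier G" "C = M #> g" by (auto simp: RCOSETS_def)
  have gM: "g \<notin> M" using C g by (auto simp: coset_join2 sM)
  define N where "N = {x \<in> carrier G. \<forall>h\<in>M. x \<otimes> h \<otimes> inv x \<in> M}"
  have gN: "g \<in> N"
  proof -
    have "g \<otimes> h \<otimes> inv g \<in> M" if h: "h \<in> M" for h
    proof -
      have "M #> g #> h = M #> g"
        using C(3)[of "inv h"] h g mem by (simp add: sM subgroup.m_inv_closed)
      then have "g \<otimes> h \<in> M #> g"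
        using rcos_self[OF g(1) sM] h mem unfolding r_coset_def by blast
      then obtain k where "k \<in> M" "g \<otimes> h = k \<otimes> g" by (auto simp: r_coset_def)
      then show ?thesis using g mem by (simp add: m_assoc)
    qed
    then show ?thesis using g by (simp add: N_def)
  qed
  have sN: "subgroup N G"
  proof (rule subgroupI)
    show "N \<subseteq> carrier G" by (auto simp: N_def)
    show "N \<noteq> {}" using gN by auto
  next
    fix x assume x: "x \<in> N"
    then have xc: "x \<in> carrier G" by (simp add: N_def)
    have inj: "inj_on (\<lambda>h. x \<otimes> h \<otimes> inv x) M"
      by (rule inj_onI) (use xc mem in simp)
    \<comment> \<open>\<open>N\<close> only asks that conjugation map \<open>M\<close> into itself.
      As \<open>M\<close> is finite, it then maps onto \<open>M\<close>, which makes
      \<open>N\<close> closed under inverses.\<close>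
    have "(\<lambda>h. x \<otimes> h \<otimes> inv x) ` M = M"
      by (rule endo_inj_surj[OF finM _ inj]) (use x in \<open>auto simp: N_def\<close>)
    moreover have "inv x \<otimes> (x \<otimes> h \<otimes> inv x) \<otimes> inv (inv x) = h" if "h \<in> M" for h
      using that xc mem by (simp add: m_assoc) (simp add: m_assoc[symmetric])
    ultimately have "inv x \<otimes> k \<otimes> inv (inv x) \<in> M" if "k \<in> M" for k
      using that by (metis (mono_tags, lifting) imageE)
    then show "inv x \<in> N" using xc by (simp add: N_def)
  next
    fix x y assume xy: "x \<in> N" "y \<in> N"
    then have c: "x \<in> carrier G" "y \<in> carrier G" by (auto simp: N_def)
    have "x \<otimes> y \<otimes> h \<otimes> inv (x \<otimes> y) \<in> M" if h: "h \<in> M" for h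
    proof -
      have "x \<otimes> (y \<otimes> h \<otimes> inv y) \<otimes> inv x \<in> M" using xy h by (simp add: N_def)
      then show ?thesis using c h mem by (simp add: m_assoc inv_mult_group)
    qed
    then show "x \<otimes> y \<in> N" using c by (simp add: N_def)
  qed
  have "M \<subseteq> N"
    using sM mem by (auto simp: N_def subgroup.m_closed subgroup.m_inv_closed)
  then have "N = carrier G"
    using M sN gN gM by (auto simp: maximal_subgroup_def proper_subgroup_def)
  then have "\<forall>x\<in>carrier G. \<forall>h\<in>M. x \<otimes> h \<otimes> inv x \<in> M" by (auto simp: N_def)
  then show ?thesis using sM by (simp add: normal_inv_iff)
qed

text \<open>Any nontrivial \<open>x\<close> has order \<open>p\<close>, so its powers with exponents
  from 0 to \<open>p - 1\<close> are distinct and exhaust the group.\<close>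

lemma (in group) prime_order_iso_integer_mod_group:
  assumes p: "Factorial_Ring.prime p" and order: "order G = p"
  shows "G \<cong> integer_mod_group p"
proof -
  have fin: "finite (carrier G)"
    using order p order_gt_0_iff_finite prime_gt_0_nat by metis
  have "carrier G \<noteq> {\<one>}" using order prime_gt_1_nat[OF p] by (auto simp: order_def)
  then obtain x where x: "x \<in> carrier G" "x \<noteq> \<one>" by blast
  have "ord x dvd p" using ord_dvd_group_order x order by simp
  moreover have "ord x \<noteq> 1" using x ord_eq_1 by auto
  ultimately have ord: "ord x = p" using p by (metis prime_nat_iff)
  have p0: "p \<noteq> 0" using p by auto
  have "(\<lambda>k::int. x [^] k) \<in> iso (integer_mod_group p) G"
  proof (rule isoI)
    show "(\<lambda>k::int. x [^] k) \<in> hom (integer_mod_group p) G"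
    proof (rule homI)
      fix i j :: int
      have "x [^] ((i + j) mod int p) = x [^] (i + j)"
        using x ord by (simp add: int_pow_eq mod_eq_dvd_iff[symmetric])
      then show "x [^] (i \<otimes>\<^bsub>integer_mod_group p\<^esub> j) = x [^] i \<otimes> x [^] j"
        using x by (simp add: int_pow_mult)
    qed (use x in simp)
    have inj: "inj_on (\<lambda>k::int. x [^] k) {0..<int p}"
    proof (rule inj_onI)
      fix i j :: int assume ij: "i \<in> {0..<int p}" "j \<in> {0..<int p}" "x [^] i = x [^] j"
      then have "int p dvd i - j"
        using x ord by (simp add: int_pow_eq dvd_diff_commute)
      then have "i mod int p = j mod int p" by (simp only: mod_eq_dvd_iff)
      then show "i = j" using ij by simp
    qed
    have "(\<lambda>k::int. x [^] k) ` {0..<int p} = carrier G"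
    proof (rule card_subset_eq[OF fin])
      show "card ((\<lambda>k::int. x [^] k) ` {0..<int p}) = card (carrier G)"
        using order by (simp add: card_image[OF inj] order_def)
    qed (use x in auto)
    then show "bij_betw (\<lambda>k::int. x [^] k) (carrier (integer_mod_group p)) (carrier G)"
      using inj p0 by (simp add: bij_betw_def carrier_integer_mod_group)
  qed
  then show ?thesis
    using group.iso_sym[OF group_integer_mod_group] by (auto simp: is_iso_def)
qed

text \<open>\<open>G Mod M\<close> is a nontrivial \<open>p\<close>-group, so it has a subgroup
  \<open>H\<close> of order \<open>p\<close>. The preimage \<open>K\<close> of \<open>H\<close>
  properly contains \<open>M\<close>, hence is everything by maximality. Thus the quotient has order
  \<open>p\<close>, and the projection followed by an isomorphism is the required character.\<close>

lemma (in group) maximal_subgroup_kernel: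
  assumes p: "Factorial_Ring.prime (p::nat)" and order: "order G = p ^ e"
    and M: "maximal_subgroup M G"
  shows "\<exists>\<phi>\<in>hom G (integer_mod_group p). M = kernel G (integer_mod_group p) \<phi>"
proof -
  interpret N: normal M G by (rule maximal_subgroup_normal[OF assms])
  interpret Q: group "G Mod M" by (rule N.factorgroup_is_group)
  interpret q: group_hom G "G Mod M" "\<lambda>x. M #> x"
    by (simp add: group_hom_def group_hom_axioms_def N.r_coset_hom_Mod)
  have sM: "subgroup M G" and MG: "M \<noteq> carrier G"
    using M by (auto simp: maximal_subgroup_def proper_subgroup_def)
  have fin: "finite (carrier G)"
    using order p order_gt_0_iff_finite by (metis prime_gt_0_nat zero_less_power)
  have lag: "order (G Mod M) * card M = p ^ e"
    using lagrange[OF sM] order by (simp add: order_def FactGroup_def)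
  then obtain i where i: "order (G Mod M) = p ^ i"
    using divides_primepow_nat[OF p] by (metis dvd_triv_left)
  have "i \<noteq> 0"
  proof
    assume "i = 0"
    then have "card M = card (carrier G)" using lag i order by (simp add: order_def)
    then show False using MG subgroup.subset[OF sM] fin card_subset_eq by blast
  qed
  then have "order (G Mod M) = p ^ 1 * p ^ (i - 1)" using i by (simp add: power_eq_if)
  moreover have finQ: "finite (carrier (G Mod M))"
    using i p Q.order_gt_0_iff_finite by (metis prime_gt_0_nat zero_less_power)
  ultimately obtain H where H: "subgroup H (G Mod M)" "card H = p"
    using sylow_thm[OF p Q.is_group] by (metis power_one_right)
  define K where "K = {x \<in> carrier G. M #> x \<in> H}"
  have sK: "subgroup K G"
  proof (rule subgroupI)
    have "M #> \<one> \<in> H" using subgroup.one_closed[OF H(1)] q.hom_one by simp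
    then show "K \<noteq> {}" unfolding K_def by blast
  next
    fix x assume "x \<in> K"
    then show "inv x \<in> K"
      unfolding K_def using subgroup.m_inv_closed[OF H(1)] q.hom_inv by fastforce
  next
    fix x y assume "x \<in> K" "y \<in> K"
    then show "x \<otimes> y \<in> K"
      unfolding K_def using subgroup.m_closed[OF H(1)] q.hom_mult by fastforce
  qed (auto simp: K_def)
  have one: "\<one>\<^bsub>G Mod M\<^esub> = M" by (simp add: FactGroup_def)
  have "M \<subseteq> K"
    using subgroup.one_closed[OF H(1)] one coset_join2[OF _ sM] subgroup.mem_carrier[OF sM]
    by (auto simp: K_def)
  moreover have "K \<noteq> M"
  proof
    assume KM: "K = M"
    have "H \<subseteq> {M}"
    proof
      fix C assume C: "C \<in> H"
      then have "C \<in> carrier (G Mod M)" using subgroup.mem_carrier[OF H(1)] by blast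
      then obtain x where x: "x \<in> carrier G" "C = M #> x" by (auto simp: FactGroup_def RCOSETS_def)
      then have "x \<in> M" using C KM by (auto simp: K_def)
      then show "C \<in> {M}" using x coset_join2[OF _ sM] by auto
    qed
    then have "card H \<le> 1" using card_mono[of "{M}" H] by simp
    then show False using H(2) prime_gt_1_nat[OF p] by simp
  qed
  ultimately have KG: "K = carrier G"
    using M sK by (auto simp: maximal_subgroup_def proper_subgroup_def)
  have "carrier (G Mod M) \<subseteq> H"
  proof
    fix C assume "C \<in> carrier (G Mod M)"
    then obtain x where x: "x \<in> carrier G" "C = M #> x" by (auto simp: FactGroup_def RCOSETS_def)
    then have "x \<in> K" using KG by simp
    then show "C \<in> H" using x by (simp add: K_def)
  qed
  then have "order (G Mod M) = p"
    using H subgroup.subset[OF H(1)] by (metis order_def subset_antisym)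
  then obtain \<psi> where \<psi>: "\<psi> \<in> iso (G Mod M) (integer_mod_group p)"
    using Q.prime_order_iso_integer_mod_group[OF p] by (auto simp: is_iso_def)
  have hom: "\<psi> \<in> hom (G Mod M) (integer_mod_group p)" and
    inj: "inj_on \<psi> (carrier (G Mod M))"
    using \<psi> by (auto simp: iso_def bij_betw_def)
  have \<psi>1: "\<psi> M = 0"
    using hom_one[OF hom Q.is_group group_integer_mod_group] one by simp
  have "(\<psi> \<circ> (\<lambda>x. M #> x)) \<in> hom G (integer_mod_group p)"
    by (rule Group.hom_compose[OF q.homh hom])
  moreover have "M = kernel G (integer_mod_group p) (\<psi> \<circ> (\<lambda>x. M #> x))"
  proof
    show "M \<subseteq> kernel G (integer_mod_group p) (\<psi> \<circ> (\<lambda>x. M #> x))"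
      using coset_join2[OF _ sM] subgroup.mem_carrier[OF sM] \<psi>1 by (auto simp: kernel_def)
    show "kernel G (integer_mod_group p) (\<psi> \<circ> (\<lambda>x. M #> x)) \<subseteq> M"
    proof
      fix x assume "x \<in> kernel G (integer_mod_group p) (\<psi> \<circ> (\<lambda>x. M #> x))"
      then have x: "x \<in> carrier G" "\<psi> (M #> x) = \<psi> M" using \<psi>1 by (auto simp: kernel_def)
      have "M #> x = M"
        using inj_onD[OF inj x(2)] q.hom_closed[OF x(1)] Q.one_closed one by simp
      then show "x \<in> M" using coset_join1[OF _ x(1) sM] subgroup.subset[OF sM] by blast
    qed
  qed
  ultimately show ?thesis by blast
qed

section \<open>Covers by kernels of characters\<close>

text \<open>Bezout's identity supplies an inverse \<open>v\<close> of \<open>b\<close> modulo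
  \<open>p\<close>, and \<open>- a * v\<close> reduced modulo \<open>p\<close> is the
  solution.\<close>

lemma ex1_solution_mod_prime:
  assumes p: "Factorial_Ring.prime (p::nat)" and b: "\<not> int p dvd b"
  shows "\<exists>!t. t < p \<and> int p dvd a + int t * b"
proof -
  have pr: "Factorial_Ring.prime (int p)" using p by simp
  have "coprime (int p) b" using b pr prime_imp_coprime by blast
  then obtain u v where uv: "u * int p + v * b = 1"
    using bezout_int[of "int p" b] by auto
  define t where "t = nat ((- a * v) mod int p)"
  have p0: "int p > 0" using p prime_gt_0_nat by simp
  have t: "int t = (- a * v) mod int p" using p0 by (simp add: t_def)
  have "t < p" using t p0 by (metis of_nat_less_iff pos_mod_bound)
  moreover have "int p dvd a + int t * b"
  proof -
    have "int p dvd (- a * v) - int t" unfolding t by (simp add: mod_eq_dvd_iff[symmetric])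
    then have "int p dvd ((- a * v) - int t) * b" by simp
    moreover have "a + int t * b = a * u * int p - ((- a * v) - int t) * b"
      using uv by (simp add: algebra_simps) (metis distrib_left mult.right_neutral)
    ultimately show ?thesis by simp
  qed
  moreover have "s = t" if s: "s < p" "int p dvd a + int s * b"
    and t: "t < p" "int p dvd a + int t * b" for s t
  proof -
    have "int p dvd (a + int s * b) - (a + int t * b)" using s t by (blast intro: dvd_diff)
    then have "int p dvd (int s - int t) * b" by (simp add: algebra_simps)
    then have "int p dvd int s - int t" using b pr prime_dvd_mult_iff by blast
    then have "int s mod int p = int t mod int p" by (simp only: mod_eq_dvd_iff)
    then show ?thesis using s t by simp
  qed
  ultimately show ?thesis by blast
qed

section \<open>Maps that are additive modulo p\<close>

context group
begin

text \<open>A homomorphism to the integers modulo \<open>p\<close>, given by arbitrary integer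
  representatives; sums and differences of characters then need no reduction.\<close>

definition additive_mod :: "nat \<Rightarrow> ('a \<Rightarrow> int) \<Rightarrow> bool" where
  "additive_mod p f \<longleftrightarrow>
     (\<forall>x\<in>carrier G. \<forall>y\<in>carrier G. int p dvd f (x \<otimes> y) - (f x + f y))"

lemma additive_mod_hom:
  assumes "f \<in> hom G (integer_mod_group p)"
  shows "additive_mod p f"
  unfolding additive_mod_def using hom_mult[OF assms]
  by (simp add: mod_eq_dvd_iff[symmetric])

lemma additive_mod_add:
  assumes "additive_mod p f" "additive_mod p h"
  shows "additive_mod p (\<lambda>x. f x + h x)"
proof -
  have "int p dvd (f (x \<otimes> y) - (f x + f y)) + (h (x \<otimes> y) - (h x + h y))"
    if "x \<in> carrier G" "y \<in> carrier G" for x y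
    using assms that unfolding additive_mod_def by (blast intro: dvd_add)
  then show ?thesis unfolding additive_mod_def by (simp add: algebra_simps)
qed

lemma additive_mod_diff:
  assumes "additive_mod p f" "additive_mod p h"
  shows "additive_mod p (\<lambda>x. f x - h x)"
proof -
  have "int p dvd (f (x \<otimes> y) - (f x + f y)) - (h (x \<otimes> y) - (h x + h y))"
    if "x \<in> carrier G" "y \<in> carrier G" for x y
    using assms that unfolding additive_mod_def by (blast intro: dvd_diff)
  then show ?thesis unfolding additive_mod_def by (simp add: algebra_simps)
qed

lemma additive_mod_pow:
  assumes f: "additive_mod p f" and x: "x \<in> carrier G" and y: "y \<in> carrier G"
  shows "int p dvd f (x \<otimes> y [^] (t::nat)) - (f x + int t * f y)"
proof (induction t)
  case 0
  then show ?case using x by simp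
next
  case (Suc t)
  have "x \<otimes> y [^] Suc t = (x \<otimes> y [^] t) \<otimes> y" using x y by (simp add: m_assoc)
  then have 1: "int p dvd f (x \<otimes> y [^] Suc t) - (f (x \<otimes> y [^] t) + f y)"
    using f x y by (simp add: additive_mod_def)
  have "f (x \<otimes> y [^] Suc t) - (f x + int (Suc t) * f y) =
      (f (x \<otimes> y [^] Suc t) - (f (x \<otimes> y [^] t) + f y)) +
      (f (x \<otimes> y [^] t) - (f x + int t * f y))"
    by (simp add: distrib_right del: nat_pow_Suc)
  then show ?case using dvd_add[OF 1 Suc] by (simp only:)
qed

lemma sum_translate:
  assumes "subgroup N G" "y \<in> N"
  shows "(\<Sum>x\<in>N. F (x \<otimes> y)) = sum F N"
proof (rule sum.reindex_bij_betw)
  note mem = subgroup.mem_carrier[OF assms(1)]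
  show "bij_betw (\<lambda>x. x \<otimes> y) N N"
    by (rule bij_betw_byWitness[where f' = "\<lambda>x. x \<otimes> inv y"])
      (use assms mem in \<open>auto simp: m_assoc subgroup.m_closed subgroup.m_inv_closed\<close>)
qed

text \<open>Along \<open>x \<otimes> y [^] t\<close> with \<open>t < p\<close> the values of
  \<open>f\<close> run once through all residues, so each \<open>x\<close> has exactly one translate
  in the kernel. Summing over \<open>N\<close> and exchanging the sums counts the kernel
  \<open>p\<close> times.\<close>

lemma card_kernel_additive_mod:
  assumes p: "Factorial_Ring.prime p" and fin: "finite (carrier G)" and N: "subgroup N G"
    and f: "additive_mod p f" and y: "y \<in> N" "\<not> int p dvd f y"
  shows "p * card {x \<in> N. int p dvd f x} = card N"
proof -
  note mem = subgroup.mem_carrier[OF N]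
  have finN: "finite N" using fin subgroup.subset[OF N] finite_subset by blast
  have yt: "y [^] (t::nat) \<in> N" for t
    by (induction t) (use y N in \<open>auto simp: subgroup.one_closed subgroup.m_closed\<close>)
  have "card N = (\<Sum>x\<in>N. \<Sum>t<p. of_bool (int p dvd f x + int t * f y))"
  proof -
    have "(\<Sum>t<p. of_bool (int p dvd f x + int t * f y)) = (1::nat)" for x
    proof -
      obtain t where "{t. t < p \<and> int p dvd f x + int t * f y} = {t}"
        using ex1_solution_mod_prime[OF p y(2), of "f x"] by blast
      then show ?thesis by (simp add: sum.If_cases of_bool_def Int_def)
    qed
    then show ?thesis by simp
  qed
  also have "\<dots> = (\<Sum>t<p. \<Sum>x\<in>N. of_bool (int p dvd f (x \<otimes> y [^] t)))"
  proof (subst sum.swap, intro sum.cong refl)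
    fix t x assume "x \<in> N"
    then have "int p dvd f (x \<otimes> y [^] t) - (f x + int t * f y)"
      using additive_mod_pow[OF f] mem y by blast
    then have "int p dvd f (x \<otimes> y [^] t) \<longleftrightarrow> int p dvd f x + int t * f y"
      by (metis dvd_diff_right_iff diff_add_cancel dvd_add_right_iff)
    then show "of_bool (int p dvd f x + int t * f y) = of_bool (int p dvd f (x \<otimes> y [^] t))"
      by simp
  qed
  also have "\<dots> = (\<Sum>t<p. \<Sum>x\<in>N. of_bool (int p dvd f x))"
    using sum_translate[OF N yt, of "\<lambda>x. of_bool (int p dvd f x) :: nat"] by simp
  also have "(\<Sum>x\<in>N. of_bool (int p dvd f x)) = card {x \<in> N. int p dvd f x}"
    using finN by (simp add: sum.If_cases of_bool_def Int_def)
  finally show ?thesis by simp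
qed

end

text \<open>The situation in a finite \<open>p\<close>-group once each member is the kernel of a
  character. Irredundancy takes the form of a private element in each member, core-freeness that of
  a trivial intersection.\<close>

locale hyperplane_cover = group G for G (structure) +
  fixes p :: nat and \<C> :: "'a set set" and \<phi> :: "'a set \<Rightarrow> 'a \<Rightarrow> int"
  assumes prime: "Factorial_Ring.prime p"
    and finite_carrier: "finite (carrier G)"
    and finite_cover: "finite \<C>"
    and card_cover: "card \<C> = 8"
    and hom: "M \<in> \<C> \<Longrightarrow> \<phi> M \<in> hom G (integer_mod_group p)"
    and kernel: "M \<in> \<C> \<Longrightarrow> M = kernel G (integer_mod_group p) (\<phi> M)"
    and Union_cover: "\<Union>\<C> = carrier G"
    and irredundant: "M \<in> \<C> \<Longrightarrow> \<exists>x\<in>M. \<forall>N\<in>\<C> - {M}. x \<notin> N"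
    and Inter_cover: "\<Inter>\<C> = {\<one>}"
begin

lemma additive_\<phi>: "M \<in> \<C> \<Longrightarrow> additive_mod p (\<phi> M)"
  using additive_mod_hom hom by blast

lemma mem_iff:
  assumes "M \<in> \<C>"
  shows "x \<in> M \<longleftrightarrow> x \<in> carrier G \<and> int p dvd \<phi> M x"
proof -
  have p0: "p \<noteq> 0" using prime by auto
  have "\<phi> M x \<in> {0..<int p}" if "x \<in> carrier G"
    using hom_in_carrier[OF hom[OF assms] that] p0 by (simp add: carrier_integer_mod_group)
  then have "\<phi> M x = 0 \<longleftrightarrow> int p dvd \<phi> M x" if "x \<in> carrier G"
    using that zdvd_imp_le[of "int p" "\<phi> M x"] by fastforce
  then show ?thesis using kernel[OF assms] by (auto simp: kernel_def)
qed

lemma subgroup_member: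
  assumes "M \<in> \<C>"
  shows "subgroup M G"
proof -
  interpret group_hom G "integer_mod_group p" "\<phi> M"
    using hom[OF assms] by (simp add: group_hom_def group_hom_axioms_def is_group)
  show ?thesis using subgroup_kernel kernel[OF assms] by simp
qed

lemma member_subset: "M \<in> \<C> \<Longrightarrow> M \<subseteq> carrier G"
  using Union_cover by blast

text \<open>A private element of \<open>M\<close> lies outside \<open>N\<close>, so
  \<open>\<phi> N\<close> does not vanish on \<open>M\<close> and its kernel there has index
  \<open>p\<close>.\<close>

lemma card_member_Int:
  assumes "M \<in> \<C>" "N \<in> \<C>" "M \<noteq> N"
  shows "p * card (M \<inter> N) = card M"
proof -
  obtain y where y: "y \<in> M" "y \<notin> N" using irredundant[OF assms(1)] assms by blast
  then have "\<not> int p dvd \<phi> N y" using mem_iff[OF assms(2)] member_subset[OF assms(1)] by blast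
  moreover have "M \<inter> N = {x \<in> M. int p dvd \<phi> N x}"
    using mem_iff[OF assms(2)] member_subset[OF assms(1)] by blast
  ultimately show ?thesis
    using card_kernel_additive_mod[OF prime finite_carrier subgroup_member[OF assms(1)]
        additive_\<phi>[OF assms(2)] y(1)] by simp
qed

lemma card_member:
  assumes "M \<in> \<C>"
  shows "p * card M = card (carrier G)"
proof -
  have "\<C> - {M} \<noteq> {}"
  proof
    assume "\<C> - {M} = {}"
    then have "card \<C> \<le> 1" using card_mono[of "{M}" \<C>] by auto
    then show False using card_cover by simp
  qed
  then obtain N where N: "N \<in> \<C>" "N \<noteq> M" by blast
  then obtain y where y: "y \<in> N" "y \<notin> M" using irredundant[OF N(1)] assms by blast
  then have "y \<in> carrier G" using member_subset[OF N(1)] by blast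
  moreover have "\<not> int p dvd \<phi> M y" using y mem_iff[OF assms] calculation by blast
  moreover have "M = {x \<in> carrier G. int p dvd \<phi> M x}" using mem_iff[OF assms] by blast
  ultimately show ?thesis
    using card_kernel_additive_mod[OF prime finite_carrier subgroup_self additive_\<phi>[OF assms]]
    by simp
qed

section \<open>Moments and bounds of the coverage function\<close>

definition coverage :: "'a \<Rightarrow> int" where
  "coverage x = int (card {M \<in> \<C>. x \<in> M})"

lemma coverage_eq_sum: "coverage x = (\<Sum>M\<in>\<C>. of_bool (x \<in> M))"
  using finite_cover by (simp add: coverage_def sum.If_cases of_bool_def Int_def)

lemma coverage_one: "coverage \<one> = 8"
proof -
  have "{M \<in> \<C>. \<one> \<in> M} = \<C>" using subgroup_member subgroup.one_closed by blast
  then show ?thesis by (simp add: coverage_def card_cover)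
qed

lemma coverage_ge_1:
  assumes "x \<in> carrier G"
  shows "coverage x \<ge> 1"
proof -
  obtain M where "M \<in> \<C>" "x \<in> M" using assms Union_cover by blast
  then have "card {M \<in> \<C>. x \<in> M} \<noteq> 0" using finite_cover by auto
  then show ?thesis by (simp add: coverage_def)
qed

lemma sum_of_bool_mem:
  assumes "A \<subseteq> carrier G"
  shows "(\<Sum>x\<in>carrier G. of_bool (x \<in> A)) = int (card A)"
  using finite_carrier assms by (simp add: sum.If_cases of_bool_def Int_absorb1)

text \<open>Double counting of incidences between elements and the eight members, each of index
  \<open>p\<close>; the factor \<open>int p\<close> avoids division.\<close>

lemma sum_coverage: "int p * (\<Sum>x\<in>carrier G. coverage x) = 8 * int (card (carrier G))"
proof -
  have "(\<Sum>x\<in>carrier G. coverage x) = (\<Sum>M\<in>\<C>. \<Sum>x\<in>carrier G. of_bool (x \<in> M))"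
    unfolding coverage_eq_sum by (rule sum.swap)
  also have "\<dots> = (\<Sum>M\<in>\<C>. int (card M))"
    using sum_of_bool_mem member_subset by simp
  finally have "int p * (\<Sum>x\<in>carrier G. coverage x) = (\<Sum>M\<in>\<C>. int (p * card M))"
    by (simp add: sum_distrib_left)
  then show ?thesis using card_member card_cover by simp
qed

text \<open>Counts ordered pairs of members through each element. After scaling by the square of
  \<open>p\<close>, the 8 diagonal pairs contribute \<open>p\<close> times the group order each, and
  the 56 other pairs the group order each.\<close>

lemma sum_coverage_sq:
  "(int p)\<^sup>2 * (\<Sum>x\<in>carrier G. (coverage x)\<^sup>2) = (8 * int p + 56) * int (card (carrier G))"
proof -
  have "(\<Sum>x\<in>carrier G. (coverage x)\<^sup>2) =
      (\<Sum>x\<in>carrier G. \<Sum>M\<in>\<C>. \<Sum>N\<in>\<C>. of_bool (x \<in> M \<inter> N))"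
    unfolding coverage_eq_sum power2_eq_square sum_product by (intro sum.cong refl) auto
  also have "\<dots> = (\<Sum>M\<in>\<C>. \<Sum>N\<in>\<C>. \<Sum>x\<in>carrier G. of_bool (x \<in> M \<inter> N))"
    by (subst sum.swap) (intro sum.cong refl sum.swap)
  also have "\<dots> = (\<Sum>M\<in>\<C>. \<Sum>N\<in>\<C>. int (card (M \<inter> N)))"
    by (intro sum.cong refl sum_of_bool_mem) (use member_subset in blast)
  finally have "(int p)\<^sup>2 * (\<Sum>x\<in>carrier G. (coverage x)\<^sup>2) =
      (\<Sum>M\<in>\<C>. \<Sum>N\<in>\<C>. int (p * (p * card (M \<inter> N))))"
    by (simp add: sum_distrib_left power2_eq_square mult.assoc)
  also have "\<dots> = (\<Sum>M\<in>\<C>. (8 + (int p - 1)) * int (card (carrier G)))"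
  proof (intro sum.cong refl)
    fix M assume M: "M \<in> \<C>"
    have "(\<Sum>N\<in>\<C>. int (p * (p * card (M \<inter> N)))) =
        (\<Sum>N\<in>\<C>. int (card (carrier G)) + of_bool (N = M) * ((int p - 1) * int (card (carrier G))))"
    proof (intro sum.cong refl)
      fix N assume N: "N \<in> \<C>"
      show "int (p * (p * card (M \<inter> N))) =
          int (card (carrier G)) + of_bool (N = M) * ((int p - 1) * int (card (carrier G)))"
      proof (cases "N = M")
        case True
        then show ?thesis using card_member[OF M] by (simp add: algebra_simps)
      next
        case False
        then show ?thesis using card_member_Int[OF M N] card_member[OF M] by simp
      qed
    qed
    also have "\<dots> = (8 + (int p - 1)) * int (card (carrier G))"
      using M finite_cover card_cover
      by (simp add: sum.distrib of_bool_def if_distrib[of "\<lambda>z. z * _"] distrib_right cong: if_cong)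
        (simp add: algebra_simps)
    finally show "(\<Sum>N\<in>\<C>. int (p * (p * card (M \<inter> N)))) = \<dots>" .
  qed
  finally show ?thesis by (simp add: card_cover algebra_simps)
qed

text \<open>Combines both moments and removes the term of the identity, whose coverage is 8. For
  \<open>a\<close> and \<open>b\<close> that fix the sign of the summands this bounds the group
  order.\<close>

lemma sum_coverage_quadratic:
  "(int p)\<^sup>2 * (\<Sum>x\<in>carrier G - {\<one>}. (coverage x - a) * (coverage x - b)) =
    (8 * int p + 56 - 8 * (a + b) * int p + a * b * (int p)\<^sup>2) * int (card (carrier G))
      - (int p)\<^sup>2 * ((8 - a) * (8 - b))"
proof -
  let ?S = "\<Sum>x\<in>carrier G. (coverage x - a) * (coverage x - b)"
  have S: "?S = (\<Sum>x\<in>carrier G. (coverage x)\<^sup>2) - (a + b) * (\<Sum>x\<in>carrier G. coverage x)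
      + a * b * int (card (carrier G))"
    by (simp add: algebra_simps power2_eq_square sum.distrib sum_subtractf sum_distrib_left)
  have "(int p)\<^sup>2 * ?S = (int p)\<^sup>2 * (\<Sum>x\<in>carrier G. (coverage x)\<^sup>2)
      - (a + b) * int p * (int p * (\<Sum>x\<in>carrier G. coverage x))
      + a * b * (int p)\<^sup>2 * int (card (carrier G))"
    unfolding S by (simp add: algebra_simps power2_eq_square)
  also have "\<dots> = (8 * int p + 56 - 8 * (a + b) * int p + a * b * (int p)\<^sup>2) * int (card (carrier G))"
    unfolding sum_coverage sum_coverage_sq by (simp add: algebra_simps)
  finally have 1: "(int p)\<^sup>2 * ?S = \<dots>" .
  have 2: "?S = (8 - a) * (8 - b) + (\<Sum>x\<in>carrier G - {\<one>}. (coverage x - a) * (coverage x - b))"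
    by (subst sum.remove[of _ \<one>]) (use finite_carrier coverage_one in auto)
  show ?thesis using 1 unfolding 2 distrib_left by linarith
qed

text \<open>If \<open>y\<close> avoids all members containing \<open>x\<close>, then a member of the cover meets the coset
  \<open>y\<langle>x\<rangle>\<close> in at most one point, so \<open>p\<close> further members are needed to cover it.\<close>

lemma coverage_le:
  assumes x: "x \<in> carrier G" "x \<noteq> \<one>"
  shows "coverage x \<le> 8 - int p"
proof -
  let ?A = "{M \<in> \<C>. x \<in> M}" and ?B = "{M \<in> \<C>. x \<notin> M}"
  have "x \<notin> \<Inter>\<C>" using x Inter_cover by simp
  then obtain M where M: "M \<in> \<C>" "x \<notin> M" by blast
  then obtain y where y: "y \<in> M" "\<forall>N\<in>\<C> - {M}. y \<notin> N" using irredundant by blast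
  have yc: "y \<in> carrier G" using y M member_subset by blast
  have yA: "y \<notin> N" if "N \<in> ?A" for N using y M that by blast
  have ex: "\<exists>N\<in>?B. y \<otimes> x [^] t \<in> N" for t :: nat
  proof -
    have "y \<otimes> x [^] t \<in> carrier G" using x yc by simp
    then obtain N where N: "N \<in> \<C>" "y \<otimes> x [^] t \<in> N" using Union_cover by blast
    have "x \<notin> N"
    proof
      assume xN: "x \<in> N"
      note sN = subgroup_member[OF N(1)]
      have xt: "x [^] t \<in> N"
        by (induction t) (use xN sN in \<open>auto simp: subgroup.one_closed subgroup.m_closed\<close>)
      then have "y \<otimes> x [^] t \<otimes> inv (x [^] t) \<in> N"
        using N sN by (simp add: subgroup.m_closed subgroup.m_inv_closed)
      then have "y \<in> N" using x yc by (simp add: m_assoc)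
      then show False using yA[of N] N xN by blast
    qed
    then show ?thesis using N by blast
  qed
  then obtain h where h: "\<And>t. h t \<in> ?B" "\<And>t. y \<otimes> x [^] (t::nat) \<in> h t" by metis
  have "inj_on h {..<p}"
  proof (rule inj_onI)
    fix s t assume st: "s \<in> {..<p}" "t \<in> {..<p}" "h s = h t"
    define N where "N = h s"
    have N: "N \<in> \<C>" "x \<notin> N" using h(1)[of s] by (auto simp: N_def)
    have "\<not> int p dvd \<phi> N x" using N x mem_iff[OF N(1)] by blast
    then have "\<exists>!t. t < p \<and> int p dvd \<phi> N y + int t * \<phi> N x"
      by (rule ex1_solution_mod_prime[OF prime])
    moreover have "int p dvd \<phi> N y + int t * \<phi> N x" if "y \<otimes> x [^] t \<in> N" for t :: nat
      using additive_mod_pow[OF additive_\<phi>[OF N(1)] yc x(1), of t] mem_iff[OF N(1)] that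
      by (metis dvd_diff_right_iff)
    ultimately show "s = t" using st h(2)[of s] h(2)[of t] by (auto simp: N_def)
  qed
  then have "p \<le> card ?B"
    using card_inj_on_le[of h "{..<p}" ?B] h(1) finite_cover by auto
  moreover have "card ?A + card ?B = card \<C>"
    using finite_cover by (subst card_Un_disjoint[symmetric]) (auto intro!: arg_cong[where f = card])
  ultimately show ?thesis by (simp add: coverage_def card_cover)
qed

end

section \<open>Possible primes, structure of the group, first bounds on its order\<close>

context hyperplane_cover
begin

lemma private_element:
  obtains e where "\<And>M N. M \<in> \<C> \<Longrightarrow> N \<in> \<C> \<Longrightarrow> e M \<in> N \<longleftrightarrow> N = M"
proof -
  have "\<forall>M\<in>\<C>. \<exists>x. \<forall>N\<in>\<C>. x \<in> N \<longleftrightarrow> N = M" using irredundant by blast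
  then show ?thesis using that by metis
qed

text \<open>A product of private elements, one for each member, lies in no member, as \<open>8\<close> is even.\<close>

lemma p_neq_2: "p \<noteq> 2"
proof
  assume p: "p = 2"
  have mult_mem: "x \<otimes> y \<in> M \<longleftrightarrow> (x \<in> M \<longleftrightarrow> y \<in> M)"
    if M: "M \<in> \<C>" and xy: "x \<in> carrier G" "y \<in> carrier G" for M x y
  proof -
    have "2 dvd \<phi> M (x \<otimes> y) - (\<phi> M x + \<phi> M y)"
      using additive_\<phi>[OF M] xy p by (simp add: additive_mod_def)
    then have "even (\<phi> M (x \<otimes> y)) \<longleftrightarrow> (even (\<phi> M x) \<longleftrightarrow> even (\<phi> M y))" by simp
    then show ?thesis using mem_iff[OF M] xy p by simp
  qed
  obtain e where e: "\<And>M N. M \<in> \<C> \<Longrightarrow> N \<in> \<C> \<Longrightarrow> e M \<in> N \<longleftrightarrow> N = M"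
    using private_element by blast
  \<comment> \<open>The witness is the product of \<open>e N\<close> over \<open>N\<close> in
    \<open>\<B>\<close>. Members have index 2 and \<open>e N\<close> lies outside every member
    except \<open>N\<close>, so membership in \<open>M\<close> depends on the parity of the number
    of factors other than \<open>e M\<close>.\<close>
  have "\<exists>x\<in>carrier G. \<forall>M\<in>\<C>. x \<in> M \<longleftrightarrow> even (card (\<B> - {M}))" if "finite \<B>" "\<B> \<subseteq> \<C>" for \<B>
    using that
  proof (induction \<B> rule: finite_induct)
    case empty
    then show ?case using subgroup.one_closed[OF subgroup_member] by auto
  next
    case (insert N \<B>)
    then obtain x where x: "x \<in> carrier G" "\<forall>M\<in>\<C>. x \<in> M \<longleftrightarrow> even (card (\<B> - {M}))" by auto
    have N: "N \<in> \<C>" using insert by simp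
    have eN: "e N \<in> carrier G" using e N member_subset by blast
    have "x \<otimes> e N \<in> M \<longleftrightarrow> even (card (insert N \<B> - {M}))" if M: "M \<in> \<C>" for M
    proof (cases "M = N")
      case True
      then show ?thesis using mult_mem[OF M x(1) eN] x M e[OF N M] by (simp add: insert_Diff_if)
    next
      case False
      then show ?thesis using mult_mem[OF M x(1) eN] x M e[OF N M] insert.hyps
        by (simp add: insert_Diff_if)
    qed
    then show ?case using x eN by blast
  qed
  then obtain x where x: "x \<in> carrier G" "\<forall>M\<in>\<C>. x \<in> M \<longleftrightarrow> even (card (\<C> - {M}))"
    using finite_cover by blast
  then obtain M where M: "M \<in> \<C>" "x \<in> M" using Union_cover by blast
  then have "card (\<C> - {M}) = 7" using card_cover finite_cover by simp
  then show False using x M by auto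
qed

text \<open>A private element is not the identity, so the two coverage bounds give
  \<open>1 \<le> 8 - p\<close>.\<close>

lemma p_cases: "p = 3 \<or> p = 5 \<or> p = 7"
proof -
  obtain e where e: "\<And>M N. M \<in> \<C> \<Longrightarrow> N \<in> \<C> \<Longrightarrow> e M \<in> N \<longleftrightarrow> N = M"
    using private_element by blast
  have "\<not> \<C> \<subseteq> {M}" for M
    using card_mono[of "{M}" \<C>] card_cover by auto
  then obtain M N where MN: "M \<in> \<C>" "N \<in> \<C>" "M \<noteq> N" by (metis insertI1 subsetI)
  then have "e M \<in> carrier G" "e M \<noteq> \<one>"
    using e[of M M] e[of M N] member_subset subgroup.one_closed[OF subgroup_member[of N]] by auto
  then have "p \<le> 7" using coverage_le[of "e M"] coverage_ge_1[of "e M"] by simp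
  moreover have "\<not> Factorial_Ring.prime (4::nat)" "\<not> Factorial_Ring.prime (6::nat)"
    using primes_dvd_imp_eq[of 2 "4::nat"] primes_dvd_imp_eq[of 2 "6::nat"] two_is_prime_nat
    by auto
  moreover have "p \<ge> 2" using prime prime_ge_2_nat by blast
  moreover have "p = 2 \<or> p = 3 \<or> p = 4 \<or> p = 5 \<or> p = 6 \<or> p = 7" if "p \<le> 7" "p \<ge> 2"
    using that by presburger
  ultimately show ?thesis using p_neq_2 prime by blast
qed

text \<open>Greedy selection: a member containing the intersection so far is dropped, and any other
  divides the order of that intersection by \<open>p\<close>.\<close>

lemma independent_members:
  assumes "finite \<B>" "\<B> \<subseteq> \<C>"
  shows "\<exists>\<S>\<subseteq>\<B>. carrier G \<inter> \<Inter>\<S> = carrier G \<inter> \<Inter>\<B> \<and>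
    card (carrier G \<inter> \<Inter>\<S>) * p ^ card \<S> = card (carrier G)"
  using assms
proof (induction \<B> rule: finite_induct)
  case empty
  then show ?case by simp
next
  case (insert M \<B>)
  then obtain \<S> where S: "\<S> \<subseteq> \<B>" "carrier G \<inter> \<Inter>\<S> = carrier G \<inter> \<Inter>\<B>"
    "card (carrier G \<inter> \<Inter>\<S>) * p ^ card \<S> = card (carrier G)" by auto
  let ?K = "carrier G \<inter> \<Inter>\<S>"
  have M: "M \<in> \<C>" using insert by simp
  show ?case
  proof (cases "?K \<subseteq> M")
    case True
    then have "carrier G \<inter> \<Inter>\<S> = carrier G \<inter> \<Inter>(insert M \<B>)" using S(2) by auto
    then show ?thesis using S by (intro exI[of _ \<S>]) auto
  next
    case False
    then obtain y where y: "y \<in> ?K" "y \<notin> M" by blast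
    have sK: "subgroup ?K G"
    proof (rule subgroupI)
      show "?K \<noteq> {}" using y by blast
    qed (use S insert.prems subgroup_member in
          \<open>auto intro!: subgroup.m_inv_closed subgroup.m_closed\<close>)
    have "\<not> int p dvd \<phi> M y" using y mem_iff[OF M] by blast
    then have "p * card {x \<in> ?K. int p dvd \<phi> M x} = card ?K"
      using card_kernel_additive_mod[OF prime finite_carrier sK additive_\<phi>[OF M]] y by blast
    moreover have "{x \<in> ?K. int p dvd \<phi> M x} = carrier G \<inter> \<Inter>(insert M \<S>)"
      using mem_iff[OF M] by auto
    moreover have "card (insert M \<S>) = Suc (card \<S>)"
      using S(1) insert.hyps by (intro card_insert_disjoint) (auto dest: finite_subset)
    ultimately have "card (carrier G \<inter> \<Inter>(insert M \<S>)) * p ^ card (insert M \<S>) = card (carrier G)"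
      using S(3) by (metis mult.commute mult.left_commute power_Suc)
    moreover have "carrier G \<inter> \<Inter>(insert M \<S>) = carrier G \<inter> \<Inter>(insert M \<B>)"
      using S(2) by auto
    ultimately show ?thesis using S(1) by (intro exI[of _ "insert M \<S>"]) auto
  qed
qed

text \<open>The characters of independent members with trivial intersection serve as coordinates:
  together they are injective, and equality of orders makes them surjective.\<close>

lemma iso_cyclic_power: "\<exists>d. card (carrier G) = p ^ d \<and> G \<cong> cyclic_power p d"
proof -
  obtain \<S> where S: "\<S> \<subseteq> \<C>" "carrier G \<inter> \<Inter>\<S> = {\<one>}" "card (carrier G) = p ^ card \<S>"
    using independent_members[OF finite_cover subset_refl] Inter_cover by auto
  define d where "d = card \<S>"
  have p0: "p \<noteq> 0" using prime by auto
  have "finite \<S>" using S(1) finite_cover finite_subset by blast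
  then obtain h where h: "bij_betw h {..<d} \<S>"
    using ex_bij_betw_nat_finite[of \<S>] by (auto simp: d_def atLeast0LessThan)
  have hC: "h i \<in> \<C>" if "i < d" for i using h that S(1) by (auto simp: bij_betw_def)
  have grp: "group (cyclic_power p d)" by (simp add: cyclic_power_def)
  define f where "f x = (\<lambda>i\<in>{..<d}. \<phi> (h i) x)" for x
  have f: "f \<in> hom G (cyclic_power p d)"
  proof (rule homI)
    fix x assume "x \<in> carrier G"
    then show "f x \<in> carrier (cyclic_power p d)"
      using hom_in_carrier[OF hom[OF hC]] by (auto simp: f_def cyclic_power_def)
  next
    fix x y assume "x \<in> carrier G" "y \<in> carrier G"
    then show "f (x \<otimes> y) = f x \<otimes>\<^bsub>cyclic_power p d\<^esub> f y"
      using hom_mult[OF hom[OF hC]] by (auto simp: f_def cyclic_power_def)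
  qed
  interpret f: group_hom G "cyclic_power p d" f
    using f grp is_group by (simp add: group_hom_def group_hom_axioms_def)
  have inj: "inj_on f (carrier G)"
  proof (rule f.inj_on_one_iff[THEN iffD2], intro allI impI)
    fix x assume x: "x \<in> carrier G" "f x = \<one>\<^bsub>cyclic_power p d\<^esub>"
    have "x \<in> h i" if i: "i < d" for i
    proof -
      have "f x i = 0" using x i by (simp add: cyclic_power_def)
      then have "\<phi> (h i) x = 0" using i by (simp add: f_def)
      then show ?thesis using mem_iff[OF hC[OF i]] x by simp
    qed
    then have "x \<in> carrier G \<inter> \<Inter>\<S>" using h x by (auto simp: bij_betw_def)
    then show "x = \<one>" using S(2) by simp
  qed
  have "card (carrier (cyclic_power p d)) = p ^ d"
    using p0 by (simp add: cyclic_power_def card_PiE carrier_integer_mod_group)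
  moreover have "finite (carrier (cyclic_power p d))"
    using p0 by (auto simp: cyclic_power_def carrier_integer_mod_group intro!: finite_PiE)
  ultimately have "f ` carrier G = carrier (cyclic_power p d)"
    using S(3) f.hom_closed card_image[OF inj]
    by (intro card_subset_eq) (auto simp: d_def)
  then have "f \<in> iso G (cyclic_power p d)" using f inj by (simp add: iso_def bij_betw_def)
  then show ?thesis using S(3) by (auto simp: d_def is_iso_def)
qed

text \<open>Both coverage bounds equal 1 here, so the quadratic with roots 0 and 1 vanishes off the
  identity, and the moment identity can be solved for the order.\<close>

lemma card_if_p_eq_7:
  assumes "p = 7"
  shows "card (carrier G) = 49"
proof -
  have "(coverage x - 0) * (coverage x - 1) = 0" if "x \<in> carrier G - {\<one>}" for x
    using that coverage_ge_1[of x] coverage_le[of x] assms by auto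
  then have "(\<Sum>x\<in>carrier G - {\<one>}. (coverage x - 0) * (coverage x - 1)) = 0" by (intro sum.neutral) blast
  then show ?thesis using sum_coverage_quadratic[of 0 1] assms by simp
qed

text \<open>No integer lies strictly between 1 and 2.\<close>

lemma sum_coverage_1_2_nonneg: "(\<Sum>x\<in>carrier G - {\<one>}. (coverage x - 1) * (coverage x - 2)) \<ge> 0"
  by (intro sum_nonneg) (simp add: zero_le_mult_iff, linarith)

text \<open>Coverage lies between 1 and 3 off the identity. The roots 1, 3 bound the order from
  above by 79 and the roots 1, 2 from below by 41, but no power of 5 lies in this range.\<close>

lemma p_neq_5: "p \<noteq> 5"
proof
  assume p: "p = 5"
  have "(coverage x - 1) * (coverage x - 3) \<le> 0" if "x \<in> carrier G - {\<one>}" for x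
    using that coverage_ge_1[of x] coverage_le[of x] p by (auto simp: mult_le_0_iff)
  then have "(\<Sum>x\<in>carrier G - {\<one>}. (coverage x - 1) * (coverage x - 3)) \<le> 0" by (intro sum_nonpos) blast
  then have "card (carrier G) \<le> 79" using sum_coverage_quadratic[of 1 3] p by simp
  moreover have "card (carrier G) \<ge> 41" using sum_coverage_quadratic[of 1 2] sum_coverage_1_2_nonneg p by simp
  moreover obtain d where d: "card (carrier G) = 5 ^ d" using iso_cyclic_power p by auto
  have "card (carrier G) \<le> 5 ^ 2 \<or> 5 ^ 3 \<le> card (carrier G)"
  proof (cases "d \<le> 2")
    case True
    then show ?thesis unfolding d by (intro disjI1 power_increasing) auto
  next
    case False
    then show ?thesis unfolding d by (intro disjI2 power_increasing) auto
  qed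
  ultimately show False by simp
qed

text \<open>For order 27 the quadratic with roots 3 and 4, nonnegative at integers, has sum 40 off
  the identity. The eight private elements have coverage 1 and contribute 6 each, already
  48.\<close>

lemma card_lower_if_p_eq_3:
  assumes p: "p = 3"
  shows "card (carrier G) \<noteq> 27" "card (carrier G) \<ge> 15"
proof -
  show "card (carrier G) \<ge> 15" using sum_coverage_quadratic[of 1 2] sum_coverage_1_2_nonneg p by simp
  show "card (carrier G) \<noteq> 27"
  proof
    assume "card (carrier G) = 27"
    then have eq: "(\<Sum>x\<in>carrier G - {\<one>}. (coverage x - 3) * (coverage x - 4)) = 40"
      using sum_coverage_quadratic[of 3 4] p by simp
    obtain e where e: "\<And>M N. M \<in> \<C> \<Longrightarrow> N \<in> \<C> \<Longrightarrow> e M \<in> N \<longleftrightarrow> N = M"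
      using private_element by blast
    have ne: "coverage (e M) = 1" if "M \<in> \<C>" for M
    proof -
      have "{N \<in> \<C>. e M \<in> N} = {M}" using e that by blast
      then show ?thesis by (simp add: coverage_def)
    qed
    have inj: "inj_on e \<C>" by (rule inj_onI) (metis e)
    have sub: "e ` \<C> \<subseteq> carrier G - {\<one>}" using e member_subset ne coverage_one by fastforce
    have "(\<Sum>x\<in>e ` \<C>. (coverage x - 3) * (coverage x - 4)) = 48"
      using ne card_cover by (simp add: sum.reindex[OF inj])
    moreover have "0 \<le> (coverage x - 3) * (coverage x - 4)" for x
      by (simp add: zero_le_mult_iff, linarith)
    then have "(\<Sum>x\<in>e ` \<C>. (coverage x - 3) * (coverage x - 4)) \<le> (\<Sum>x\<in>carrier G - {\<one>}. (coverage x - 3) * (coverage x - 4))"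
      by (intro sum_mono2[OF _ sub]) (use finite_carrier in auto)
    ultimately show False using eq by simp
  qed
qed

end

section \<open>Characters of order three\<close>

text \<open>\<open>char3 a\<close> is \<open>\<omega>\<^sup>a + \<omega>\<^sup>-\<^sup>a\<close> for a primitive third root of unity \<open>\<omega>\<close>.\<close>

definition char3 :: "int \<Rightarrow> int" where
  "char3 a = (if 3 dvd a then 2 else - 1)"

text \<open>Multiplying out the two sums of roots of unity gives this rule; over the integers it is
  a check of residues modulo 3.\<close>

lemma char3_mult: "char3 a * char3 b = char3 (a + b) + char3 (a - b)"
  unfolding char3_def by (auto; presburger)

text \<open>Either every term is 2, or the kernel has index 3 and the sum is 0.\<close>

lemma (in group) sum_char3_nonneg:
  assumes fin: "finite (carrier G)" and f: "additive_mod 3 f"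
  shows "0 \<le> (\<Sum>x\<in>carrier G. char3 (f x))"
proof (cases "\<forall>x\<in>carrier G. 3 dvd f x")
  case True
  then show ?thesis by (intro sum_nonneg) (simp add: char3_def)
next
  case False
  then obtain y where y: "y \<in> carrier G" "\<not> 3 dvd f y" by blast
  have "3 * card {x \<in> carrier G. 3 dvd f x} = card (carrier G)"
    using card_kernel_additive_mod[OF _ fin subgroup_self f y(1)] y(2) by simp
  moreover have "(\<Sum>x\<in>carrier G. char3 (f x)) = (\<Sum>x\<in>carrier G. 3 * of_bool (3 dvd f x) - 1)"
    by (intro sum.cong refl) (simp add: char3_def)
  moreover have "\<dots> = 3 * int (card {x \<in> carrier G. 3 dvd f x}) - int (card (carrier G))"
    using fin by (simp add: sum_subtractf sum_distrib_left[symmetric] sum.If_cases of_bool_def Int_def)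
  ultimately show ?thesis by linarith
qed

section \<open>Weighted counts of relations between the eight characters\<close>

context hyperplane_cover
begin

text \<open>For \<open>p = 3\<close> and up to the factor \<open>|G|\<close>, this counts the linear relations between the \<open>\<phi> M\<close> whose support is
  exactly \<open>\<S>\<close>.\<close>

definition char_sum :: "'a set set \<Rightarrow> int" where
  "char_sum \<S> = (\<Sum>x\<in>carrier G. \<Prod>M\<in>\<S>. if x \<in> M then 2 else - 1)"

text \<open>With an additional factor \<open>char3 (f x)\<close>, the product rule absorbs one
  character at a time into \<open>f\<close>, as a sum and as a difference, until only plain
  character sums remain.\<close>

lemma char_sum_nonneg:
  assumes p: "p = 3" and S: "\<S> \<subseteq> \<C>"
  shows "0 \<le> char_sum \<S>"
proof -
  have "0 \<le> (\<Sum>x\<in>carrier G. char3 (f x) * (\<Prod>M\<in>\<S>. char3 (\<phi> M x)))"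
    if "finite \<S>" "\<S> \<subseteq> \<C>" "additive_mod 3 f" for \<S> f
    using that
  proof (induction \<S> arbitrary: f rule: finite_induct)
    case empty
    then show ?case using sum_char3_nonneg[OF finite_carrier] by simp
  next
    case (insert M \<S>)
    have M: "additive_mod 3 (\<phi> M)" using additive_\<phi> insert.prems p by auto
    have "char3 (f x) * (\<Prod>N\<in>insert M \<S>. char3 (\<phi> N x)) =
        char3 (f x + \<phi> M x) * (\<Prod>N\<in>\<S>. char3 (\<phi> N x)) + char3 (f x - \<phi> M x) * (\<Prod>N\<in>\<S>. char3 (\<phi> N x))" for x
      using insert.hyps by (simp add: distrib_right[symmetric] char3_mult[symmetric])
    then have "(\<Sum>x\<in>carrier G. char3 (f x) * (\<Prod>N\<in>insert M \<S>. char3 (\<phi> N x))) =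
        (\<Sum>x\<in>carrier G. char3 (f x + \<phi> M x) * (\<Prod>N\<in>\<S>. char3 (\<phi> N x))) +
        (\<Sum>x\<in>carrier G. char3 (f x - \<phi> M x) * (\<Prod>N\<in>\<S>. char3 (\<phi> N x)))"
      by (simp add: sum.distrib)
    moreover note insert.IH[OF _ additive_mod_add[OF insert.prems(2) M]]
      insert.IH[OF _ additive_mod_diff[OF insert.prems(2) M]]
    ultimately show ?case using insert.prems(1) by simp
  qed
  moreover have "finite \<S>" using S finite_cover finite_subset by blast
  moreover have "additive_mod 3 (\<lambda>x. 0)" by (simp add: additive_mod_def)
  \<comment> \<open>The zero map as \<open>f\<close> costs only the factor \<open>char3 0\<close>,
    which is 2.\<close>
  ultimately have "0 \<le> (\<Sum>x\<in>carrier G. char3 0 * (\<Prod>M\<in>\<S>. char3 (\<phi> M x)))" using S by blast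
  also have "\<dots> = 2 * char_sum \<S>"
  proof -
    have "(\<Prod>M\<in>\<S>. char3 (\<phi> M x)) = (\<Prod>M\<in>\<S>. if x \<in> M then 2 else - 1)" if "x \<in> carrier G" for x
      using that S mem_iff p by (intro prod.cong refl) (auto simp: char3_def)
    then show ?thesis by (simp add: char_sum_def char3_def sum_distrib_left)
  qed
  finally show ?thesis by simp
qed

text \<open>The sum over subsets factors into a product whose factor at \<open>M\<close> is 3 if
  \<open>x \<in> M\<close> and 0 otherwise. For \<open>p = 3\<close> a nontrivial element lies in at
  most five members, so with six or more only the identity survives.\<close>

lemma sum_char_sum_Pow:
  assumes p: "p = 3" and B: "\<B> \<subseteq> \<C>" "card \<B> \<ge> 6"
  shows "(\<Sum>\<S>\<in>Pow \<B>. char_sum \<S>) = 3 ^ card \<B>"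
proof -
  have finB: "finite \<B>" using B finite_cover finite_subset by blast
  have "(\<Sum>\<S>\<in>Pow \<B>. char_sum \<S>) = (\<Sum>x\<in>carrier G. \<Sum>\<S>\<in>Pow \<B>. \<Prod>M\<in>\<S>. if x \<in> M then 2 else - 1)"
    unfolding char_sum_def by (rule sum.swap)
  also have "\<dots> = (\<Sum>x\<in>carrier G. \<Prod>M\<in>\<B>. (if x \<in> M then 2 else - 1) + 1)"
    by (simp add: prod_add[OF finB])
  also have "\<dots> = (\<Sum>x\<in>carrier G. if x = \<one> then 3 ^ card \<B> else 0)"
  proof (intro sum.cong refl)
    fix x assume x: "x \<in> carrier G"
    show "(\<Prod>M\<in>\<B>. (if x \<in> M then 2 else - 1) + 1) = (if x = \<one> then 3 ^ card \<B> else 0 :: int)"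
    proof (cases "x = \<one>")
      case True
      have "\<one> \<in> M" if "M \<in> \<B>" for M
        using that B subgroup_member subgroup.one_closed by blast
      then show ?thesis using True by simp
    next
      case False
      have "\<not> \<B> \<subseteq> {M \<in> \<C>. x \<in> M}"
        using card_mono[of "{M \<in> \<C>. x \<in> M}" \<B>] finite_cover B(2) coverage_le[OF x False] p
        by (auto simp: coverage_def)
      then obtain M where "M \<in> \<B>" "x \<notin> M" using B by blast
      then have "(\<Prod>M\<in>\<B>. (if x \<in> M then 2 else - 1) + 1) = (0::int)"
        by (intro prod_zero[OF finB]) auto
      then show ?thesis using False by simp
    qed
  qed
  also have "\<dots> = 3 ^ card \<B>" using finite_carrier by simp
  finally show ?thesis .
qed

text \<open>The weights make the sum factor into terms that are 0 if \<open>x \<in> M\<close> and 3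
  otherwise. The total is thus a multiple of the number of uncovered elements, of which there are
  none.\<close>

lemma sum_char_sum_alternating: "(\<Sum>\<S>\<in>Pow \<C>. (- 1) ^ card \<S> * 2 ^ card (\<C> - \<S>) * char_sum \<S>) = 0"
proof -
  let ?k = "\<lambda>(x::'a) M. if x \<in> M then 2 else - 1 :: int"
  have "(\<Sum>\<S>\<in>Pow \<C>. (- 1) ^ card \<S> * 2 ^ card (\<C> - \<S>) * char_sum \<S>) =
      (\<Sum>x\<in>carrier G. \<Sum>\<S>\<in>Pow \<C>. (- 1) ^ card \<S> * 2 ^ card (\<C> - \<S>) * (\<Prod>M\<in>\<S>. ?k x M))"
    unfolding char_sum_def sum_distrib_left by (rule sum.swap)
  also have "\<dots> = (\<Sum>x\<in>carrier G. \<Prod>M\<in>\<C>. - ?k x M + 2)"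
  proof (intro sum.cong refl)
    fix x
    have "(\<Prod>M\<in>\<S>. - ?k x M) = (- 1) ^ card \<S> * (\<Prod>M\<in>\<S>. ?k x M)" for \<S>
      using prod.distrib[of "\<lambda>_. - 1" "?k x" \<S>] by simp
    then show "(\<Sum>\<S>\<in>Pow \<C>. (- 1) ^ card \<S> * 2 ^ card (\<C> - \<S>) * (\<Prod>M\<in>\<S>. ?k x M)) =
        (\<Prod>M\<in>\<C>. - ?k x M + 2)"
      unfolding prod_add[OF finite_cover] by (intro sum.cong refl) (simp only: prod_constant mult_ac)
  qed
  also have "\<dots> = 0"
  proof (rule sum.neutral, rule ballI)
    fix x assume "x \<in> carrier G"
    then obtain M where "M \<in> \<C>" "x \<in> M" using Union_cover by blast
    then show "(\<Prod>M\<in>\<C>. - ?k x M + 2) = 0" by (intro prod_zero[OF finite_cover]) auto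
  qed
  finally show ?thesis .
qed

lemma sum_char_sum_disjoint:
  assumes "A \<subseteq> \<C>"
  shows "(\<Sum>\<S>\<in>Pow \<C>. of_bool (\<S> \<inter> A = {}) * char_sum \<S>) = (\<Sum>\<S>\<in>Pow (\<C> - A). char_sum \<S>)"
proof -
  have "{\<S> \<in> Pow \<C>. \<S> \<inter> A = {}} = Pow (\<C> - A)" by blast
  then show ?thesis
    using finite_cover
    by (simp add: of_bool_def if_distrib[of "\<lambda>z. z * _"] sum.If_cases Int_def cong: if_cong)
qed

lemma card_compl: "\<S> \<subseteq> \<C> \<Longrightarrow> int (card (\<C> - \<S>)) = (\<Sum>M\<in>\<C>. of_bool (\<S> \<inter> {M} = {}))"
  using finite_cover by (simp add: sum.If_cases of_bool_def Int_def set_diff_eq)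

text \<open>\<open>card (\<C> - \<S>)\<close> counts the members \<open>M\<close> that
  \<open>\<S>\<close> avoids, and the sets avoiding \<open>M\<close> are the subsets of the other
  seven members.\<close>

lemma sum_card_char_sum:
  assumes p: "p = 3"
  shows "(\<Sum>\<S>\<in>Pow \<C>. int (card (\<C> - \<S>)) * char_sum \<S>) = 8 * 3 ^ 7"
proof -
  have "(\<Sum>\<S>\<in>Pow \<C>. int (card (\<C> - \<S>)) * char_sum \<S>) =
      (\<Sum>\<S>\<in>Pow \<C>. \<Sum>M\<in>\<C>. of_bool (\<S> \<inter> {M} = {}) * char_sum \<S>)"
    by (intro sum.cong refl) (simp only: card_compl sum_distrib_right Pow_iff)
  also have "\<dots> = (\<Sum>M\<in>\<C>. \<Sum>\<S>\<in>Pow (\<C> - {M}). char_sum \<S>)"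
    by (subst sum.swap) (rule sum.cong[OF refl], rule sum_char_sum_disjoint, blast)
  also have "\<dots> = (\<Sum>M\<in>\<C>. 3 ^ 7)"
    by (intro sum.cong refl, subst sum_char_sum_Pow[OF p]) (use card_cover finite_cover in auto)
  finally show ?thesis using card_cover by simp
qed

text \<open>Ordered pairs of avoided members leave seven members if equal and six if distinct. Six
  is the smallest size that \<open>sum_char_sum_Pow\<close> admits, hence the use of moments up to
  order two only.\<close>

lemma sum_card_sq_char_sum:
  assumes p: "p = 3"
  shows "(\<Sum>\<S>\<in>Pow \<C>. (int (card (\<C> - \<S>)))\<^sup>2 * char_sum \<S>) = 8 * (3 ^ 7 + 7 * 3 ^ 6)"
proof -
  have "(\<Sum>\<S>\<in>Pow \<C>. (int (card (\<C> - \<S>)))\<^sup>2 * char_sum \<S>) =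
      (\<Sum>\<S>\<in>Pow \<C>. \<Sum>M\<in>\<C>. \<Sum>N\<in>\<C>. of_bool (\<S> \<inter> {M, N} = {}) * char_sum \<S>)"
  proof (intro sum.cong refl)
    fix \<S> assume "\<S> \<in> Pow \<C>"
    then have "(int (card (\<C> - \<S>)))\<^sup>2 =
        (\<Sum>M\<in>\<C>. \<Sum>N\<in>\<C>. of_bool (\<S> \<inter> {M} = {}) * of_bool (\<S> \<inter> {N} = {}))"
      by (simp only: card_compl power2_eq_square sum_product Pow_iff)
    also have "\<dots> = (\<Sum>M\<in>\<C>. \<Sum>N\<in>\<C>. of_bool (\<S> \<inter> {M, N} = {}))"
      by (intro sum.cong refl) auto
    finally show "(int (card (\<C> - \<S>)))\<^sup>2 * char_sum \<S> =
        (\<Sum>M\<in>\<C>. \<Sum>N\<in>\<C>. of_bool (\<S> \<inter> {M, N} = {}) * char_sum \<S>)"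
      by (simp only: sum_distrib_right)
  qed
  also have "\<dots> = (\<Sum>M\<in>\<C>. \<Sum>N\<in>\<C>. \<Sum>\<S>\<in>Pow \<C>. of_bool (\<S> \<inter> {M, N} = {}) * char_sum \<S>)"
    by (subst sum.swap) (rule sum.cong[OF refl], rule sum.swap)
  also have "\<dots> = (\<Sum>M\<in>\<C>. \<Sum>N\<in>\<C>. \<Sum>\<S>\<in>Pow (\<C> - {M, N}). char_sum \<S>)"
    by (rule sum.cong[OF refl], rule sum.cong[OF refl], rule sum_char_sum_disjoint) blast
  also have "\<dots> = (\<Sum>M\<in>\<C>. 3 ^ 7 + 7 * 3 ^ 6)"
  proof (intro sum.cong refl)
    fix M assume M: "M \<in> \<C>"
    have "(\<Sum>N\<in>\<C>. \<Sum>\<S>\<in>Pow (\<C> - {M, N}). char_sum \<S>) =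
        (\<Sum>\<S>\<in>Pow (\<C> - {M}). char_sum \<S>) + (\<Sum>N\<in>\<C> - {M}. \<Sum>\<S>\<in>Pow (\<C> - {M, N}). char_sum \<S>)"
      by (subst sum.remove[OF finite_cover M]) simp
    also have "(\<Sum>\<S>\<in>Pow (\<C> - {M}). char_sum \<S>) = 3 ^ 7"
      using M card_cover finite_cover by (subst sum_char_sum_Pow[OF p]) auto
    also have "(\<Sum>N\<in>\<C> - {M}. \<Sum>\<S>\<in>Pow (\<C> - {M, N}). char_sum \<S>) = (\<Sum>N\<in>\<C> - {M}. 3 ^ 6)"
    proof (intro sum.cong refl)
      fix N assume "N \<in> \<C> - {M}"
      then have "{M, N} \<subseteq> \<C>" "M \<noteq> N" using M by auto
      then have "card (\<C> - {M, N}) = 6"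
        using card_cover by (simp add: card_Diff_subset)
      then show "(\<Sum>\<S>\<in>Pow (\<C> - {M, N}). char_sum \<S>) = 3 ^ 6"
        by (subst sum_char_sum_Pow[OF p]) auto
    qed
    also have "\<dots> = 7 * 3 ^ 6" using M card_cover finite_cover by simp
    finally show "(\<Sum>N\<in>\<C>. \<Sum>\<S>\<in>Pow (\<C> - {M, N}). char_sum \<S>) = 3 ^ 7 + 7 * 3 ^ 6" .
  qed
  finally show ?thesis using card_cover by simp
qed

text \<open>As \<open>card \<S>\<close> and \<open>z = card (\<C> - \<S>)\<close> have the same
  parity, the alternating weight is the \<open>z\<close>-th power of -2. A quadratic minorant, with
  equality at \<open>z = 1\<close> and \<open>z = 3\<close>, reduces the vanishing sum to known
  moments. The empty relation, corrected to its exact weight, brings in the group order, which is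
  then at most 189.\<close>

lemma card_upper_if_p_eq_3:
  assumes p: "p = 3"
  shows "card (carrier G) < 243"
proof -
  let ?z = "\<lambda>\<S>. card (\<C> - \<S>)"
  \<comment> \<open>\<open>-5z\<^sup>2 + 17z - 14\<close> is at most \<open>(-2)^z\<close> for \<open>0 \<le> z \<le> 7\<close>; at \<open>z = 8\<close> it is \<open>-198 = 256 - 454\<close>.\<close>
  have "-5 * (int (?z \<S>))\<^sup>2 * char_sum \<S> + 17 * int (?z \<S>) * char_sum \<S> - 14 * char_sum \<S> + of_bool (\<S> = {}) * (454 * char_sum {})
      \<le> (- 1) ^ card \<S> * 2 ^ ?z \<S> * char_sum \<S>" if S: "\<S> \<in> Pow \<C>" for \<S>
  proof (cases "\<S> = {}")
    case True
    then show ?thesis using card_cover by simp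
  next
    case False
    have fS: "finite \<S>" using S finite_cover finite_subset by blast
    then have "card \<S> \<noteq> 0" using False by simp
    moreover have "?z \<S> = 8 - card \<S>" "card \<S> \<le> 8"
      using S fS card_cover card_Diff_subset[of \<S> \<C>] card_mono[OF finite_cover, of \<S>] by auto
    moreover have "card \<S> = 1 \<or> card \<S> = 2 \<or> card \<S> = 3 \<or> card \<S> = 4 \<or> card \<S> = 5 \<or>
        card \<S> = 6 \<or> card \<S> = 7 \<or> card \<S> = 8" if "card \<S> \<noteq> 0" "card \<S> \<le> 8"
      using that by presburger
    ultimately have "-5 * (int (?z \<S>))\<^sup>2 + 17 * int (?z \<S>) - 14 \<le> (- 1) ^ card \<S> * 2 ^ ?z \<S>"
      by auto
    then have "(-5 * (int (?z \<S>))\<^sup>2 + 17 * int (?z \<S>) - 14) * char_sum \<S> \<le> ((- 1) ^ card \<S> * 2 ^ ?z \<S>) * char_sum \<S>"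
      using char_sum_nonneg[OF p] S by (intro mult_right_mono) auto
    then show ?thesis using False by (simp add: algebra_simps)
  qed
  then have "(\<Sum>\<S>\<in>Pow \<C>. -5 * (int (?z \<S>))\<^sup>2 * char_sum \<S> + 17 * int (?z \<S>) * char_sum \<S> - 14 * char_sum \<S>
      + of_bool (\<S> = {}) * (454 * char_sum {})) \<le> 0"
    \<comment> \<open>Replaces the bound 0 by the alternating sum, so that the termwise estimate
      applies.\<close>
    unfolding sum_char_sum_alternating[symmetric] by (rule sum_mono)
  moreover have "(\<Sum>\<S>\<in>Pow \<C>. of_bool (\<S> = {}) * (454 * char_sum {})) = 454 * char_sum {}"
    using finite_cover by (simp add: of_bool_def if_distrib[of "\<lambda>z. z * _"] cong: if_cong)
  moreover have "char_sum {} = int (card (carrier G))" by (simp add: char_sum_def)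
  moreover have "(\<Sum>\<S>\<in>Pow \<C>. char_sum \<S>) = 3 ^ 8"
    using sum_char_sum_Pow[OF p subset_refl] card_cover by simp
  ultimately have "-5 * (8 * (3 ^ 7 + 7 * 3 ^ 6)) + 17 * (8 * 3 ^ 7) - 14 * 3 ^ 8
      + 454 * int (card (carrier G)) \<le> 0"
    using sum_card_char_sum[OF p] sum_card_sq_char_sum[OF p]
    by (simp add: sum.distrib sum_subtractf mult.assoc sum_distrib_left[symmetric] sum_negf)
  then show ?thesis by simp
qed

end

section \<open>Classification\<close>

lemma (in hyperplane_cover) iso_cases: "G \<cong> cyclic_power 3 4 \<or> G \<cong> cyclic_power 7 2"
proof -
  obtain d where d: "card (carrier G) = p ^ d" "G \<cong> cyclic_power p d"
    using iso_cyclic_power by blast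
  consider "p = 3" | "p = 7" using p_cases p_neq_5 by blast
  then show ?thesis
  proof cases
    case 1
    then have "(3::nat) ^ d < 3 ^ 5" using card_upper_if_p_eq_3 d(1) by simp
    then have "d < 5" by (rule power_less_imp_less_exp[rotated]) simp
    \<comment> \<open>The exponents 0, 1, 2 give orders below 15, and the exponent 3 gives
      27.\<close>
    moreover have "\<not> (d = 0 \<or> d = 1 \<or> d = 2 \<or> d = 3)" 
      using card_lower_if_p_eq_3 1 d(1) by (intro notI, elim disjE) simp_all
    ultimately have "d = 4" by presburger
    then show ?thesis using d(2) 1 by simp
  next
    case 2
    then have "(7::nat) ^ d = 7 ^ 2" using card_if_p_eq_7 d(1) by simp
    then have "d = 2" by (subst (asm) power_inject_exp) simp_all
    then show ?thesis using d(2) 2 by simp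
  qed
qed

text \<open>An intersection of normal subgroups is invariant under conjugation; hence core-freeness
  makes the intersection of the cover trivial.\<close>

lemma (in group) Inter_normal_subset_core:
  assumes "\<And>M. M \<in> \<C> \<Longrightarrow> M \<lhd> G" "\<C> \<noteq> {}"
  shows "\<Inter>\<C> \<subseteq> normal_core G (\<Inter>\<C>)"
proof
  fix x assume x: "x \<in> \<Inter>\<C>"
  obtain M where "M \<in> \<C>" using assms(2) by blast
  then have xc: "x \<in> carrier G"
    using x subgroup.mem_carrier[OF normal_imp_subgroup[OF assms(1)]] by blast
  have "x \<in> inv g <# (\<Inter>\<C> #> g)" if g: "g \<in> carrier G" for g
  proof -
    have "g \<otimes> x \<otimes> inv g \<in> \<Inter>\<C>"
      using x normal.inv_op_closed2[OF assms(1) g] by blast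
    moreover have "x = inv g \<otimes> ((g \<otimes> x \<otimes> inv g) \<otimes> g)"
      using xc g by (simp add: m_assoc) (simp add: m_assoc[symmetric])
    ultimately show ?thesis unfolding l_coset_def r_coset_def by blast
  qed
  then show "x \<in> normal_core G (\<Inter>\<C>)" by (simp add: normal_core_def)
qed

text \<open>The \<open>k\<close>-th power of an element has coordinates that are multiples of
  \<open>k\<close> reduced modulo \<open>k\<close>, so element orders divide the prime
  \<open>k\<close>.\<close>

lemma (in group) p_group_if_iso_cyclic_power:
  assumes "Factorial_Ring.prime k" "G \<cong> cyclic_power k m"
  shows "p_group k G"
proof -
  obtain f where f: "f \<in> iso G (cyclic_power k m)" using assms(2) by (auto simp: is_iso_def)
  have grp: "group (cyclic_power k m)" by (simp add: cyclic_power_def)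
  interpret f: group_hom G "cyclic_power k m" f
    using f grp is_group by (simp add: group_hom_def group_hom_axioms_def iso_def)
  have pow: "(y [^]\<^bsub>cyclic_power k m\<^esub> (t::nat)) i = (int t * y i) mod int k"
    if "i < m" for y t i
  proof (induction t)
    case 0
    then show ?case using that by (simp add: cyclic_power_def)
  next
    case (Suc t)
    have "(y [^]\<^bsub>cyclic_power k m\<^esub> Suc t) i = ((y [^]\<^bsub>cyclic_power k m\<^esub> t) i + y i) mod int k"
      using that by (simp add: cyclic_power_def)
    also have "\<dots> = (int t * y i + y i) mod int k" unfolding Suc by (rule mod_add_left_eq)
    finally show ?case by (simp add: distrib_right add.commute)
  qed
  have "\<exists>j. ord x = k ^ j" if x: "x \<in> carrier G" for x
  proof -
    have y: "f x \<in> carrier (cyclic_power k m)" using x by simp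
    have "f (x [^] k) = f x [^]\<^bsub>cyclic_power k m\<^esub> k" using x by (rule f.hom_nat_pow)
    also have "\<dots> = \<one>\<^bsub>cyclic_power k m\<^esub>"
    proof (rule PiE_ext)
      show "f x [^]\<^bsub>cyclic_power k m\<^esub> k \<in> PiE {..<m} (\<lambda>_. carrier (integer_mod_group k))"
        using monoid.nat_pow_closed[OF group.is_monoid[OF grp] y] by (simp add: cyclic_power_def)
      show "\<one>\<^bsub>cyclic_power k m\<^esub> \<in> PiE {..<m} (\<lambda>_. carrier (integer_mod_group k))"
        by (simp add: cyclic_power_def)
      show "(f x [^]\<^bsub>cyclic_power k m\<^esub> k) i = \<one>\<^bsub>cyclic_power k m\<^esub> i" if "i \<in> {..<m}" for i
        using that by (subst pow) (auto simp: cyclic_power_def)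
    qed
    finally have "f (x [^] k) = f \<one>" by simp
    moreover have "inj_on f (carrier G)" using f by (simp add: iso_def bij_betw_def)
    ultimately have "x [^] k = \<one>" using x by (meson inj_onD nat_pow_closed one_closed)
    then have "ord x dvd k ^ 1" using x by (simp add: pow_eq_id)
    then show ?thesis using divides_primepow_nat[OF assms(1)] by blast
  qed
  then show ?thesis using is_group by (simp add: p_group_def)
qed

theorem theorem1p5:
  fixes G :: "('a, 'b) monoid_scheme"
  assumes "CC_group 8 G"
  shows "(\<exists>p::nat. Factorial_Ring.prime p \<and> p_group p G) \<longleftrightarrow>
           G \<cong> cyclic_power 3 4 \<or> G \<cong> cyclic_power 7 2"
proof
  interpret group G using assms by (simp add: CC_group_def)
  obtain \<C> where "CC_cover 8 G \<C>" using assms by (auto simp: CC_group_def)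
  then have irr: "irredundant_cover G \<C>" and maxi: "\<And>M. M \<in> \<C> \<Longrightarrow> maximal_subgroup M G"
    and core: "normal_core G (\<Inter>\<C>) = {\<one>\<^bsub>G\<^esub>}" and fin: "finite \<C>" and card: "card \<C> = 8"
    by (auto simp: CC_cover_def maximal_cover_def core_free_cover_def)
  have proper: "proper_subgroup M G" if "M \<in> \<C>" for M
    using maxi[OF that] by (simp add: maximal_subgroup_def)
  then have sub: "subgroup M G" if "M \<in> \<C>" for M
    using that by (simp add: proper_subgroup_def)
  have cov: "\<Union>\<C> = carrier G" using irr by (simp add: irredundant_cover_def group_cover_def)
  have irr': "\<Union>\<D> \<noteq> carrier G" if "\<D> \<subset> \<C>" for \<D>
  proof -
    have "\<not> group_cover G \<D>" using irr that by (simp add: irredundant_cover_def)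
    moreover have "\<forall>H\<in>\<D>. proper_subgroup H G" using proper that by blast
    ultimately show ?thesis by (simp add: group_cover_def)
  qed
  have ne: "\<C> \<noteq> {}" using card by auto
  then have Inter: "carrier G \<inter> \<Inter>\<C> = \<Inter>\<C>" using cov by blast
  \<comment> \<open>This holds without the \<open>p\<close>-group hypothesis: all members have
    finite index, hence so does their intersection, whose core is trivial.\<close>
  have finG: "finite (carrier G)"
  proof (rule finite_if_core_trivial[OF _ _ core])
    show "subgroup (\<Inter>\<C>) G" using subgroup_carrier_Inter[of \<C>] sub Inter by simp
    show "finite (rcosets\<^bsub>G\<^esub> (\<Inter>\<C>))"
      using finite_rcosets_Inter[OF fin sub irredundant_cover_finite_index[OF fin sub irr' cov]]
        Inter by simp
  qed
  assume "\<exists>p::nat. Factorial_Ring.prime p \<and> p_group p G"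
  then obtain p :: nat where p: "Factorial_Ring.prime p" "p_group p G" by blast
  obtain e where e: "order G = p ^ e" using finite_p_group_order[OF finG p] by blast
  have "\<forall>M\<in>\<C>. \<exists>\<phi>. \<phi> \<in> hom G (integer_mod_group p) \<and> M = kernel G (integer_mod_group p) \<phi>"
    using maximal_subgroup_kernel[OF p(1) e maxi] by blast
  then obtain \<phi> where \<phi>: "\<And>M. M \<in> \<C> \<Longrightarrow> \<phi> M \<in> hom G (integer_mod_group p)"
    "\<And>M. M \<in> \<C> \<Longrightarrow> M = kernel G (integer_mod_group p) (\<phi> M)" by metis
  have "\<one>\<^bsub>G\<^esub> \<in> \<Inter>\<C>" using sub subgroup.one_closed by blast
  then have "\<Inter>\<C> = {\<one>\<^bsub>G\<^esub>}"
    using Inter_normal_subset_core[OF maximal_subgroup_normal[OF p(1) e maxi] ne] core by auto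
  moreover have "\<exists>x\<in>M. \<forall>N\<in>\<C> - {M}. x \<notin> N" if M: "M \<in> \<C>" for M
  proof -
    have "\<Union>(\<C> - {M}) \<noteq> carrier G" using irr'[of "\<C> - {M}"] M by blast
    then show ?thesis using cov by blast
  qed
  ultimately interpret hyperplane_cover G p \<C> \<phi>
    by (intro hyperplane_cover.intro hyperplane_cover_axioms.intro is_group p(1) finG fin card \<phi> cov)
  show "G \<cong> cyclic_power 3 4 \<or> G \<cong> cyclic_power 7 2" by (rule iso_cases)
next
  have G: "group G" using assms by (simp add: CC_group_def)
  have "Factorial_Ring.prime (3::nat)" "Factorial_Ring.prime (7::nat)" by simp_all
  moreover assume "G \<cong> cyclic_power 3 4 \<or> G \<cong> cyclic_power 7 2"
  ultimately show "\<exists>p::nat. Factorial_Ring.prime p \<and> p_group p G"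
    using group.p_group_if_iso_cyclic_power[OF G] by blast
qed

end
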